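(* Let $\mathscr{P}_\bullet$ be an irreducible subfactor planar algebra and let $0<p,q\le\infty$ satisfy $1/p\le 1/2$ and $1/q\ge 1/2$. Then $C_{p,q}\le\delta^{2/q-2/p}$. Moreover, if there exists a biunitary in $\mathscr{P}_{2,\pm}$, then for $x\in\mathscr{P}_{2,\pm}$ the following statements are equivalent: (1) $\|\mathfrak{F}_s(x)\|_q=\delta^{2/q-2/p}\|x\|_p$ for some $p>0$, $q>0$ with $1/p<1/2$ and $1/q>1/2$; (2) $\|\mathfrak{F}_s(x)\|_q=\delta^{2/q-2/p}\|x\|_p$ for all $p>0$, $q>0$ with $1/p\le 1/2$ and $1/q\ge 1/2$; (3) $x$ is a multiple of a biunitary. If there is a biunitary in $\mathscr{P}_{2,\pm}$, then $C_{p,q}=\delta^{2/q-2/p}$.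
   Context: Let $\mathscr{P}_\bullet=\{\mathscr{P}_{n,\pm}\}_{n\ge 0}$ be a subfactor planar algebra in the sense of Jones, with $\delta$ the square root of the Jones index (the value of a closed loop). It is irreducible if $\mathscr{P}_{1,\pm}$ is one-dimensional. Each $\mathscr{P}_{n,\pm}$ is a finite-dimensional C$^*$-algebra and $tr_2$ denotes the unnormalized Markov trace on $\mathscr{P}_{2,\pm}$, so $tr_2(1)=\delta^2$. The string Fourier transform $\mathfrak{F}_s:\mathscr{P}_{2,\pm}\to\mathscr{P}_{2,\mp}$ is the clockwise 1-click rotation. For $x\in\mathscr{P}_{2,\pm}$, $|x|=(x^*x)^{1/2}$, $\|x\|_p=(tr_2(|x|^p))^{1/p}$ for $0<p<\infty$, and $\|x\|_\infty$ is the operator norm. Convention: exponents may equal $\infty$, with $1/\infty=0$. For $0<p,q\le\infty$, $C_{p,q}=\sup_{\|x\|_p=1}\|\mathfrak{F}_s(x)\|_q$, the supremum being over $x\in\mathscr{P}_{2,\pm}$. A unitary element $u\in\mathscr{P}_{2,\pm}$ is biunitary if $\mathfrak{F}_s(u)$ is also a unitary. "Multiple" means scalar multiple. *)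

theory Defs
  imports "HOL-Analysis.Analysis"
begin

section \<open>Shaded planar tangles\<close>

text \<open>
  Planar algebras only depend on tangles up to isotopy, so a tangle is encoded by the
  combinatorial data that determine its isotopy class.

  Label 0 is the output disc; the input discs carry nonzero labels. Disc \<open>d\<close> has
  \<open>2 * bpts T d\<close> boundary points \<open>(d,0), (d,1), \<dots>\<close>, numbered clockwise from the marked boundary
  interval. Interval \<open>(d,j)\<close> is the one ending (clockwise) at the point \<open>(d,j)\<close>, so \<open>(d,0)\<close> is the
  marked interval; a disc without boundary points has the single interval \<open>(d,0)\<close>, its whole
  boundary circle. \<open>unshaded T d\<close> says that the marked interval of \<open>d\<close> meets an unshaded region,
  i.e. that \<open>d\<close> is of type \<open>(bpts T d, +)\<close>.

  \<open>mate T\<close> sends a boundary point to the other end of its string, and \<open>reg T\<close> sends an interval to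
  (the name of) the region of the tangle whose closure contains it. Each closed string contributes
  the pair (unshaded side, shaded side) of the two regions it separates; hence the relative position
  of closed strings and of parts of the tangle that no string connects is recorded as well.
\<close>

type_synonym point = "nat \<times> nat"
type_synonym region = "nat \<times> nat"

record tangle =
  discs :: "nat set"
  bpts :: "nat \<Rightarrow> nat"
  unshaded :: "nat \<Rightarrow> bool"
  mate :: "point \<Rightarrow> point"
  reg :: "point \<Rightarrow> region"
  loops :: "(region \<times> region) multiset"

definition points :: "tangle \<Rightarrow> point set" where
  "points T = (SIGMA d : insert 0 (discs T). {..<2 * bpts T d})"

definition intervals :: "tangle \<Rightarrow> point set" where
  "intervals T = (SIGMA d : insert 0 (discs T). {..<max 1 (2 * bpts T d)})"

definition regions :: "tangle \<Rightarrow> region set" where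
  "regions T = reg T ` intervals T \<union> fst ` set_mset (loops T) \<union> snd ` set_mset (loops T)"

text \<open>
  The intervals to the left and to the right of a string at its end point \<open>(d,j)\<close>, when one looks
  from the disc \<open>d\<close> along the string. Strings leave input discs outwards but the output disc inwards,
  whence the case distinction.
\<close>

definition left_of :: "tangle \<Rightarrow> point \<Rightarrow> point" where
  "left_of T = (\<lambda>(d, j). (d, if d = 0 then Suc j mod (2 * bpts T d) else j))"

definition right_of :: "tangle \<Rightarrow> point \<Rightarrow> point" where
  "right_of T = (\<lambda>(d, j). (d, if d = 0 then j else Suc j mod (2 * bpts T d)))"

text \<open>
  Walking along a boundary component of a region with the region on the left, one passes from
  the interval left of a point \<open>p\<close>, along the string at \<open>p\<close>, to the interval right of \<open>mate T p\<close>.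
  The boundary components that are not closed strings are the classes of this relation.
\<close>

definition side_step :: "tangle \<Rightarrow> (point \<times> point) set" where
  "side_step T = (\<lambda>p. (left_of T p, right_of T (mate T p))) ` points T"

definition boundary_cycles :: "tangle \<Rightarrow> point set set" where
  "boundary_cycles T = (\<lambda>I. ((side_step T \<union> (side_step T)\<inverse>)\<^sup>*) `` {I}) ` intervals T"

definition region_adj :: "tangle \<Rightarrow> (region \<times> region) set" where
  "region_adj T =
     {(reg T (d, j), reg T (d, j')) | d j j'. (d, j) \<in> intervals T \<and> (d, j') \<in> intervals T}
     \<union> set_mset (loops T) \<union> (set_mset (loops T))\<inverse>"

text \<open>
  The last two conditions say that the data are realised in the plane. Glue a disc for every label
  (for label 0: the complement of the output disc in the sphere), the strings, and for each
  region a sphere with as many holes as the region has boundary components. The result is a closed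
  oriented surface, which is the sphere iff it is connected and its Euler characteristic
  \<open>(number of discs) - (number of non-closed strings) + \<Sum>\<^sub>r (2 - number of holes of r)\<close> is 2;
  a closed string bounds two holes.
\<close>

definition is_tangle :: "tangle \<Rightarrow> bool" where
  "is_tangle T \<longleftrightarrow>
     finite (discs T) \<and> 0 \<notin> discs T \<and>
     (\<forall>p\<in>points T. mate T p \<in> points T \<and> mate T p \<noteq> p \<and> mate T (mate T p) = p) \<and>
     (\<forall>p\<in>points T. reg T (left_of T p) = reg T (right_of T (mate T p))) \<and>
     (\<exists>shaded. (\<forall>(d, j)\<in>intervals T. reg T (d, j) \<in> shaded \<longleftrightarrow> unshaded T d \<noteq> even j) \<and>
               (\<forall>(u, v)\<in>set_mset (loops T). u \<notin> shaded \<and> v \<in> shaded)) \<and>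
     (\<forall>r\<in>regions T. \<forall>r'\<in>regions T. (r, r') \<in> (region_adj T)\<^sup>*) \<and>
     card (insert 0 (discs T)) + 2 * card (regions T) =
       2 + (\<Sum>d\<in>insert 0 (discs T). bpts T d) + card (boundary_cycles T) + 2 * size (loops T)"

text \<open>Isotopy of tangles, combined with a renaming \<open>\<sigma>\<close> of the input discs.\<close>

definition isotopic :: "(nat \<Rightarrow> nat) \<Rightarrow> tangle \<Rightarrow> tangle \<Rightarrow> bool" where
  "isotopic \<sigma> T T' \<longleftrightarrow>
     \<sigma> 0 = 0 \<and> bij_betw \<sigma> (discs T) (discs T') \<and>
     (\<forall>d\<in>insert 0 (discs T). bpts T' (\<sigma> d) = bpts T d \<and> unshaded T' (\<sigma> d) = unshaded T d) \<and>
     (\<forall>p\<in>points T. mate T' (map_prod \<sigma> id p) = map_prod \<sigma> id (mate T p)) \<and>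
     (\<exists>\<rho>. inj_on \<rho> (regions T) \<and>
          (\<forall>I\<in>intervals T. reg T' (map_prod \<sigma> id I) = \<rho> (reg T I)) \<and>
          loops T' = image_mset (map_prod \<rho> \<rho>) (loops T))"

text \<open>The (unshaded, shaded) regions on the two sides of the string ending at a given point.\<close>

definition sides :: "tangle \<Rightarrow> point \<Rightarrow> region \<times> region" where
  "sides T = (\<lambda>(d, j).
     let a = reg T (d, j); b = reg T (d, Suc j mod (2 * bpts T d))
     in if unshaded T d = even j then (a, b) else (b, a))"

text \<open>
  \<open>is_composite T i S U\<close>: inserting \<open>S\<close> into the input disc \<open>i\<close> of \<open>T\<close> and erasing the common boundary
  circle yields \<open>U\<close>. The labels of the input discs of \<open>T\<close> and \<open>S\<close> are disjoint, which is no restriction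
  by renaming. A boundary point \<open>(0,j)\<close> of \<open>S\<close> becomes the point \<open>(i,j)\<close> of \<open>T\<close>.
\<close>

definition glued_strings :: "tangle \<Rightarrow> nat \<Rightarrow> tangle \<Rightarrow> (point \<times> point) set" where
  "glued_strings T i S =
     (let \<iota> = map_prod (\<lambda>d. if d = 0 then i else d) id
      in (\<lambda>p. (p, mate T p)) ` points T \<union> (\<lambda>p. (\<iota> p, \<iota> (mate S p))) ` points S)"

text \<open>Components of the glued strings that meet no boundary point of the composite.\<close>

definition new_loops :: "tangle \<Rightarrow> nat \<Rightarrow> tangle \<Rightarrow> point set set" where
  "new_loops T i S =
     {C. (\<exists>j < 2 * bpts T i. C = ((glued_strings T i S)\<^sup>*) `` {(i, j)}) \<and> C \<subseteq> {i} \<times> UNIV}"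

text \<open>
  The maps \<open>f\<close> and \<open>g\<close> send regions of \<open>T\<close> and \<open>S\<close> to the regions of \<open>U\<close> containing them. They must identify
  the regions meeting along the erased circle; that they identify no others is forced by
  \<open>is_tangle U\<close>, since the Euler characteristic determines the number of regions of \<open>U\<close>.
\<close>

definition is_composite :: "tangle \<Rightarrow> nat \<Rightarrow> tangle \<Rightarrow> tangle \<Rightarrow> bool" where
  "is_composite T i S U \<longleftrightarrow>
     is_tangle T \<and> is_tangle S \<and> is_tangle U \<and>
     i \<in> discs T \<and> discs T \<inter> discs S = {} \<and>
     bpts S 0 = bpts T i \<and> unshaded S 0 = unshaded T i \<and>
     discs U = (discs T - {i}) \<union> discs S \<and>
     (\<forall>d\<in>insert 0 (discs T - {i}). bpts U d = bpts T d \<and> unshaded U d = unshaded T d) \<and>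
     (\<forall>d\<in>discs S. bpts U d = bpts S d \<and> unshaded U d = unshaded S d) \<and>
     (\<forall>p\<in>points U. (p, mate U p) \<in> (glued_strings T i S)\<^sup>*) \<and>
     (\<exists>f g. (\<forall>(d, j)\<in>intervals T. d = i \<longrightarrow> f (reg T (i, j)) = g (reg S (0, j))) \<and>
            (\<forall>(d, j)\<in>intervals T. d \<noteq> i \<longrightarrow> reg U (d, j) = f (reg T (d, j))) \<and>
            (\<forall>(d, j)\<in>intervals S. d \<noteq> 0 \<longrightarrow> reg U (d, j) = g (reg S (d, j))) \<and>
            loops U = image_mset (map_prod f f) (loops T) + image_mset (map_prod g g) (loops S) +
              image_mset (\<lambda>C. the_elem ((map_prod f f \<circ> sides T) ` C)) (mset_set (new_loops T i S)))"

text \<open>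
  Reflection of a tangle in a line, the marked intervals being mapped to the marked intervals.
  It reverses the clockwise numbering of points and intervals.
\<close>

definition reflect :: "tangle \<Rightarrow> tangle" where
  "reflect T =
     (let rp = (\<lambda>(d, j). (d, 2 * bpts T d - 1 - j))
      in T\<lparr>mate := rp \<circ> mate T \<circ> rp,
           reg := (\<lambda>(d, j). reg T (d, (2 * bpts T d - j) mod (2 * bpts T d)))\<rparr>)"

subsection \<open>Some tangles\<close>

text \<open>
  Discs with \<open>2 * n\<close> points are drawn as rectangles with the marked interval on the left,
  points \<open>0, \<dots>, n-1\<close> on top from left to right and \<open>n, \<dots>, 2n-1\<close> at the bottom from right to left.
  The sign \<open>s\<close> is \<open>True\<close> for \<open>+\<close>.
\<close>

definition id_tangle :: "nat \<Rightarrow> bool \<Rightarrow> tangle" where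
  "id_tangle n s = \<lparr>discs = {1}, bpts = (\<lambda>_. n), unshaded = (\<lambda>_. s),
     mate = (\<lambda>(d, j). (1 - d, j)), reg = (\<lambda>(d, j). (0, j)), loops = {#}\<rparr>"

definition unit_tangle :: "nat \<Rightarrow> bool \<Rightarrow> tangle" where
  "unit_tangle n s = \<lparr>discs = {}, bpts = (\<lambda>_. n), unshaded = (\<lambda>_. s),
     mate = (\<lambda>(d, j). (d, 2 * n - 1 - j)), reg = (\<lambda>(d, j). (0, min j (2 * n - j))), loops = {#}\<rparr>"

text \<open>Disc 1 is stacked on top of disc 2.\<close>

definition mult_tangle :: "nat \<Rightarrow> bool \<Rightarrow> tangle" where
  "mult_tangle n s = \<lparr>discs = {1, 2}, bpts = (\<lambda>_. n), unshaded = (\<lambda>_. s),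
     mate = (\<lambda>(d, j).
       if d = 0 then (if j < n then (1, j) else (2, j))
       else if d = 1 then (if j < n then (0, j) else (2, 2 * n - 1 - j))
       else (if j < n then (1, 2 * n - 1 - j) else (0, j))),
     reg = (\<lambda>(d, j).
       if d = 0 then (0, j)
       else if d = 1 then (if j \<le> n then (0, j) else (1, j))
       else (if j = 0 \<or> n \<le> j then (0, j) else (1, 2 * n - j))),
     loops = {#}\<rparr>"

text \<open>The strings at the top of disc 1 are joined to those at the bottom around its right side.\<close>

definition trace_tangle :: "nat \<Rightarrow> bool \<Rightarrow> tangle" where
  "trace_tangle n s = \<lparr>discs = {1}, bpts = (\<lambda>d. if d = 0 then 0 else n), unshaded = (\<lambda>_. s),
     mate = (\<lambda>(d, j). (d, 2 * n - 1 - j)),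
     reg = (\<lambda>(d, j). if d = 0 then (1, 0) else (1, min j (2 * n - j))), loops = {#}\<rparr>"

text \<open>A single closed string in a disc whose boundary is unshaded iff \<open>s\<close>.\<close>

definition loop_tangle :: "bool \<Rightarrow> tangle" where
  "loop_tangle s = \<lparr>discs = {}, bpts = (\<lambda>_. 0), unshaded = (\<lambda>_. s),
     mate = id, reg = (\<lambda>_. (0, 0)),
     loops = {#if s then ((0, 0), (0, 1)) else ((0, 1), (0, 0))#}\<rparr>"

text \<open>Clockwise rotation by one click: the input disc is turned clockwise, so that its point \<open>j\<close> is
  joined to point \<open>j+1\<close> of the output disc.\<close>

definition rotation_tangle :: "nat \<Rightarrow> bool \<Rightarrow> tangle" where
  "rotation_tangle n s = \<lparr>discs = {1}, bpts = (\<lambda>_. n), unshaded = (\<lambda>d. if d = 0 then \<not> s else s),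
     mate = (\<lambda>(d, j). if d = 0 then (1, (j + 2 * n - 1) mod (2 * n)) else (0, (j + 1) mod (2 * n))),
     reg = (\<lambda>(d, j). if d = 0 then (0, j) else (0, (j + 1) mod (2 * n))), loops = {#}\<rparr>"

section \<open>Subfactor planar algebras\<close>

text \<open>
  \<open>spc A n s\<close> is the space \<open>P\<^bsub>n,s\<^esub>\<close>; all these spaces are realised as subspaces of one complex vector
  space \<open>'a\<close> with scalar multiplication \<open>scl A\<close>. \<open>act A T x\<close> is \<open>Z\<^sub>T\<close> applied to the inputs \<open>x d\<close>,
  \<open>d \<in> discs T\<close>.
\<close>

record 'a planar =
  scl :: "complex \<Rightarrow> 'a \<Rightarrow> 'a"
  spc :: "nat \<Rightarrow> bool \<Rightarrow> 'a set"
  act :: "tangle \<Rightarrow> (nat \<Rightarrow> 'a) \<Rightarrow> 'a"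
  star :: "nat \<Rightarrow> bool \<Rightarrow> 'a \<Rightarrow> 'a"

definition inputs :: "'a planar \<Rightarrow> tangle \<Rightarrow> (nat \<Rightarrow> 'a) set" where
  "inputs A T = {x. \<forall>d\<in>discs T. x d \<in> spc A (bpts T d) (unshaded T d)}"

definition planar_algebra :: "('a::ab_group_add) planar \<Rightarrow> bool" where
  "planar_algebra A \<longleftrightarrow>
     vector_space (scl A) \<and>
     (\<forall>n s. module.subspace (scl A) (spc A n s)) \<and>
     (\<forall>T x. is_tangle T \<and> x \<in> inputs A T \<longrightarrow> act A T x \<in> spc A (bpts T 0) (unshaded T 0)) \<and>
     (\<forall>T x y. is_tangle T \<and> x \<in> inputs A T \<and> (\<forall>d\<in>discs T. x d = y d) \<longrightarrow> act A T x = act A T y) \<and>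
     (\<forall>T x d v w a b. is_tangle T \<and> x \<in> inputs A T \<and> d \<in> discs T \<and>
        v \<in> spc A (bpts T d) (unshaded T d) \<and> w \<in> spc A (bpts T d) (unshaded T d) \<longrightarrow>
        act A T (x(d := scl A a v + scl A b w)) =
          scl A a (act A T (x(d := v))) + scl A b (act A T (x(d := w)))) \<and>
     (\<forall>\<sigma> T T' x. is_tangle T \<and> is_tangle T' \<and> isotopic \<sigma> T T' \<and> x \<in> inputs A T' \<longrightarrow>
        act A T' x = act A T (x \<circ> \<sigma>)) \<and>
     (\<forall>n s. \<forall>v\<in>spc A n s. act A (id_tangle n s) (\<lambda>_. v) = v) \<and>
     (\<forall>T i S U x. is_composite T i S U \<and> x \<in> inputs A U \<longrightarrow>
        act A U x = act A T (x(i := act A S x)))"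

definition planar_star_algebra :: "('a::ab_group_add) planar \<Rightarrow> bool" where
  "planar_star_algebra A \<longleftrightarrow>
     planar_algebra A \<and>
     (\<forall>n s. \<forall>v\<in>spc A n s. star A n s v \<in> spc A n s \<and> star A n s (star A n s v) = v) \<and>
     (\<forall>n s a b. \<forall>v\<in>spc A n s. \<forall>w\<in>spc A n s.
        star A n s (scl A a v + scl A b w) = scl A (cnj a) (star A n s v) + scl A (cnj b) (star A n s w)) \<and>
     (\<forall>T x. is_tangle T \<and> x \<in> inputs A T \<longrightarrow>
        star A (bpts T 0) (unshaded T 0) (act A T x) =
          act A (reflect T) (\<lambda>d. star A (bpts T d) (unshaded T d) (x d)))"

definition unit :: "('a::ab_group_add) planar \<Rightarrow> nat \<Rightarrow> bool \<Rightarrow> 'a" where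
  "unit A n s = act A (unit_tangle n s) (\<lambda>_. 0)"

definition mul :: "'a planar \<Rightarrow> nat \<Rightarrow> bool \<Rightarrow> 'a \<Rightarrow> 'a \<Rightarrow> 'a" where
  "mul A n s x y = act A (mult_tangle n s) (\<lambda>d. if d = 1 then x else y)"

text \<open>The identification of the one-dimensional space \<open>P\<^bsub>0,s\<^esub>\<close> with the complex numbers.\<close>

definition scalar :: "('a::ab_group_add) planar \<Rightarrow> bool \<Rightarrow> 'a \<Rightarrow> complex" where
  "scalar A s x = (THE c. x = scl A c (unit A 0 s))"

text \<open>The unnormalized Markov trace, with \<open>tr\<^sub>n(1) = \<delta>\<^sup>n\<close>.\<close>

definition tr :: "('a::ab_group_add) planar \<Rightarrow> nat \<Rightarrow> bool \<Rightarrow> 'a \<Rightarrow> complex" where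
  "tr A n s x = scalar A s (act A (trace_tangle n s) (\<lambda>_. x))"

text \<open>
  Sphericality: the scalar defined by a labelled tangle without output boundary points is invariant
  under isotopies on the sphere. Equivalently, the output disc, viewed as a disc on the
  sphere, may be moved to any other region.
\<close>

definition spherical :: "('a::ab_group_add) planar \<Rightarrow> bool" where
  "spherical A \<longleftrightarrow>
     (\<forall>T T' r s x. is_tangle T \<and> is_tangle T' \<and> bpts T 0 = 0 \<and>
        T' = T\<lparr>reg := (reg T)((0, 0) := r), unshaded := (unshaded T)(0 := s)\<rparr> \<and> x \<in> inputs A T \<longrightarrow>
        scalar A (unshaded T 0) (act A T x) = scalar A s (act A T' x))"

definition subfactor_planar_algebra :: "('a::ab_group_add) planar \<Rightarrow> bool" where
  "subfactor_planar_algebra A \<longleftrightarrow>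
     planar_star_algebra A \<and>
     (\<forall>n s. \<exists>B. finite B \<and> module.span (scl A) B = spc A n s) \<and>
     (\<forall>s. vector_space.dim (scl A) (spc A 0 s) = 1) \<and>
     spherical A \<and>
     (\<forall>n s. \<forall>x\<in>spc A n s. x \<noteq> 0 \<longrightarrow>
        Im (tr A n s (mul A n s (star A n s x) x)) = 0 \<and>
        Re (tr A n s (mul A n s (star A n s x) x)) > 0)"

definition irreducible_planar :: "('a::ab_group_add) planar \<Rightarrow> bool" where
  "irreducible_planar A \<longleftrightarrow> (\<forall>s. vector_space.dim (scl A) (spc A 1 s) = 1)"

text \<open>The value of a closed string; in the spherical case it does not depend on the shading.\<close>

definition delta :: "('a::ab_group_add) planar \<Rightarrow> real" where
  "delta A = Re (scalar A True (act A (loop_tangle True) (\<lambda>_. 0)))"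

definition fourier :: "'a planar \<Rightarrow> bool \<Rightarrow> 'a \<Rightarrow> 'a" where
  "fourier A s x = act A (rotation_tangle 2 s) (\<lambda>_. x)"

section \<open>Functional calculus and norms\<close>

definition spectral_decomposition ::
  "('a::ab_group_add) planar \<Rightarrow> nat \<Rightarrow> bool \<Rightarrow> 'a \<Rightarrow> real set \<Rightarrow> (real \<Rightarrow> 'a) \<Rightarrow> bool" where
  "spectral_decomposition A n s a S e \<longleftrightarrow>
     finite S \<and>
     (\<forall>l\<in>S. e l \<in> spc A n s \<and> star A n s (e l) = e l) \<and>
     (\<forall>l\<in>S. \<forall>m\<in>S. mul A n s (e l) (e m) = (if l = m then e l else 0)) \<and>
     (\<Sum>l\<in>S. e l) = unit A n s \<and>
     (\<Sum>l\<in>S. scl A (of_real l) (e l)) = a"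

text \<open>\<open>f(a)\<close> for self-adjoint \<open>a\<close>.\<close>

definition fun_calc ::
  "('a::ab_group_add) planar \<Rightarrow> nat \<Rightarrow> bool \<Rightarrow> (real \<Rightarrow> real) \<Rightarrow> 'a \<Rightarrow> 'a" where
  "fun_calc A n s f a =
     (THE b. \<exists>S e. spectral_decomposition A n s a S e \<and> b = (\<Sum>l\<in>S. scl A (of_real (f l)) (e l)))"

definition abs_val :: "('a::ab_group_add) planar \<Rightarrow> nat \<Rightarrow> bool \<Rightarrow> 'a \<Rightarrow> 'a" where
  "abs_val A n s x = fun_calc A n s sqrt (mul A n s (star A n s x) x)"

definition L2_length :: "('a::ab_group_add) planar \<Rightarrow> nat \<Rightarrow> bool \<Rightarrow> 'a \<Rightarrow> real" where
  "L2_length A n s x = sqrt (Re (tr A n s (mul A n s (star A n s x) x)))"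

text \<open>The operator norm of \<open>x\<close> acting by left multiplication on \<open>L\<^sup>2(P\<^bsub>n,s\<^esub>, tr\<^sub>n)\<close>.\<close>

definition op_norm :: "('a::ab_group_add) planar \<Rightarrow> nat \<Rightarrow> bool \<Rightarrow> 'a \<Rightarrow> real" where
  "op_norm A n s x = Sup {L2_length A n s (mul A n s x y) | y. y \<in> spc A n s \<and> L2_length A n s y \<le> 1}"

definition p_norm :: "('a::ab_group_add) planar \<Rightarrow> bool \<Rightarrow> ennreal \<Rightarrow> 'a \<Rightarrow> real" where
  "p_norm A s p x =
     (if p = \<infinity> then op_norm A 2 s x
      else Re (tr A 2 s (fun_calc A 2 s (\<lambda>t. t powr enn2real p) (abs_val A 2 s x)))
             powr (1 / enn2real p))"

definition C_const :: "('a::ab_group_add) planar \<Rightarrow> bool \<Rightarrow> ennreal \<Rightarrow> ennreal \<Rightarrow> ennreal" where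
  "C_const A s p q =
     (SUP x \<in> {x \<in> spc A 2 s. p_norm A s p x = 1}. ennreal (p_norm A (\<not> s) q (fourier A s x)))"

definition unitary :: "('a::ab_group_add) planar \<Rightarrow> bool \<Rightarrow> 'a \<Rightarrow> bool" where
  "unitary A s u \<longleftrightarrow>
     u \<in> spc A 2 s \<and> mul A 2 s (star A 2 s u) u = unit A 2 s \<and> mul A 2 s u (star A 2 s u) = unit A 2 s"

definition biunitary :: "('a::ab_group_add) planar \<Rightarrow> bool \<Rightarrow> 'a \<Rightarrow> bool" where
  "biunitary A s u \<longleftrightarrow> unitary A s u \<and> unitary A (\<not> s) (fourier A s u)"

text \<open>\<open>1/p\<close> for \<open>0 < p \<le> \<infinity>\<close>, with \<open>1/\<infinity> = 0\<close>.\<close>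

definition recip :: "ennreal \<Rightarrow> real" where
  "recip p = enn2real (1 / p)"

end

theory Submission
  imports Defs "HOL-Computational_Algebra.Fundamental_Theorem_Algebra"
begin

text \<open>
  The Fourier transform preserves the 2-norm: \<open>tr (x\<^sup>* x)\<close> is the value of a picture on the sphere in
  which a disc labelled \<open>x\<close> and a disc labelled \<open>x\<^sup>*\<close> are joined by four strings, and rotating both discs
  by one click changes this picture only by the position of the output disc, which does
  not matter by sphericality (\<open>fourier_isometry\<close>).

  On either side the trace has total mass \<open>\<delta>\<^sup>2\<close>, and Hoelder's inequality compares the other norms
  with the 2-norm: \<open>\<delta> powr (2 / p - 1) * \<parallel>x\<parallel>\<^sub>2 \<le> \<parallel>x\<parallel>\<^sub>p\<close> if \<open>1 / p \<le> 1 / 2\<close>, and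
  \<open>\<parallel>y\<parallel>\<^sub>q \<le> \<delta> powr (2 / q - 1) * \<parallel>y\<parallel>\<^sub>2\<close> if \<open>1 / q \<ge> 1 / 2\<close> (\<open>p_norm_compare_L2\<close>). With \<open>y\<close> the transform of \<open>x\<close>,
  these two facts give the bound on the constant. A comparison with the 2-norm involves a single
  positive element, which makes it commutative: if \<open>x\<^sup>* x\<close> is the sum of \<open>l * e l\<close> over its
  spectrum, then every norm of \<open>x\<close> is a power mean (or the maximum) of the \<open>l\<close> with the positive weights
  \<open>tr (e l)\<close>, and the inequality is one between power means of numbers.

  If equality holds for strict inequalities between the exponents, both power means are
  extremal, so the spectra of \<open>x\<^sup>* x\<close> and \<open>y\<^sup>* y\<close> consist of one point. Hence \<open>x\<close> and \<open>y\<close> are multiples, by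
  the same factor, of isometries, which are unitary in a finite-dimensional algebra. Conversely, all
  norms of a multiple of a biunitary and of its transform can be computed.

  Two bodies of material support this. That \<open>P\<^bsub>2,s\<^esub>\<close> is a *-algebra with a faithful positive
  functional, that \<open>tr 1 = \<delta>\<^sup>2\<close> and the isometry above are consequences of identities between particular
  tangles. Composition and isotopy of tangles are finite combinatorial conditions, for which
  executable criteria are proved sound; the identities then hold by evaluation.
  The spectral theorem is obtained from polynomials in a self-adjoint element: their
  values depend only on the values at the roots of the minimal polynomial, and the Lagrange polynomials
  of these roots give the spectral projections.
\<close>

section \<open>Deciding the combinatorial conditions on tangles\<close>

text \<open>
  Components of a finite graph by merging blocks, one edge at a time. The point of this
  formulation is that it evaluates on explicit tangles: boundary cycles, connectedness of the
  regions and the closed strings created by gluing are all components of such graphs.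
\<close>

definition merge_blocks :: "'b \<times> 'b \<Rightarrow> 'b list list \<Rightarrow> 'b list list" where
  "merge_blocks e bs = concat (filter (\<lambda>B. fst e \<in> set B \<or> snd e \<in> set B) bs) #
     filter (\<lambda>B. fst e \<notin> set B \<and> snd e \<notin> set B) bs"

definition components :: "'b list \<Rightarrow> ('b \<times> 'b) list \<Rightarrow> 'b list list" where
  "components vs es = fold merge_blocks es (map (\<lambda>v. [v]) vs)"

definition partition_list :: "'b set \<Rightarrow> 'b list list \<Rightarrow> bool" where
  "partition_list V bs \<longleftrightarrow> distinct (concat bs) \<and> set (concat bs) = V \<and> [] \<notin> set bs"

lemma partition_list_unique:
  assumes "partition_list V bs" "B \<in> set bs" "C \<in> set bs" "v \<in> set B" "v \<in> set C"
  shows "B = C"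
proof -
  have "B = C" if "distinct (concat bs)"
    using that assms(2-5) by (induction bs) auto
  then show ?thesis using assms(1) by (simp add: partition_list_def)
qed

lemma partition_list_distinct:
  assumes "partition_list V bs"
  shows "distinct (map set bs)"
proof -
  have "distinct (map set bs)" if "distinct (concat bs)" "[] \<notin> set bs"
    using that
  proof (induction bs)
    case (Cons B bs)
    then have "set B \<noteq> {}" "\<And>C. C \<in> set bs \<Longrightarrow> set B \<inter> set C = {}" by auto
    then have "set B \<notin> set ` set bs" by force
    then show ?case using Cons by auto
  qed simp
  then show ?thesis using assms by (auto simp: partition_list_def)
qed

lemma partition_list_merge:
  assumes "partition_list V bs" "fst e \<in> V"
  shows "partition_list V (merge_blocks e bs)"
proof -
  have 1: "distinct (concat (filter P bs) @ concat (filter (\<lambda>B. \<not> P B) bs))"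
    if "distinct (concat bs)" for P
    using that by (induction bs) auto
  have 2: "set (concat (filter P bs) @ concat (filter (\<lambda>B. \<not> P B) bs)) = set (concat bs)" for P
    by auto
  have 3: "concat (filter (\<lambda>B. fst e \<in> set B \<or> snd e \<in> set B) bs) \<noteq> []"
    using assms by (auto simp: partition_list_def)
  show ?thesis
    using assms 1[of "\<lambda>B. fst e \<in> set B \<or> snd e \<in> set B"]
      2[of "\<lambda>B. fst e \<in> set B \<or> snd e \<in> set B"] 3
    unfolding partition_list_def merge_blocks_def by simp
qed

lemma components_snoc: "components vs (es @ [e]) = merge_blocks e (components vs es)"
  by (simp add: components_def)

lemma partition_components:
  assumes "distinct vs" "fst ` set es \<subseteq> set vs"
  shows "partition_list (set vs) (components vs es)"
  using assms(2)
proof (induction es rule: rev_induct)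
  case Nil
  have "concat (map (\<lambda>v. [v]) vs) = vs" by (induction vs) auto
  then show ?case using assms(1) by (auto simp: components_def partition_list_def)
next
  case (snoc e es)
  then show ?case by (auto simp: components_snoc intro!: partition_list_merge)
qed

text \<open>
  Merging along an edge of an equivalence relation that contains the graph never leaves a class
  of the relation; this bounds the components from above.
\<close>

lemma components_sound:
  assumes "B \<in> set (components vs es)" "u \<in> set B" "v \<in> set B"
    and "sym R" "refl R" "trans R" "set es \<subseteq> R"
  shows "(u, v) \<in> R"
  using assms(1-3,7)
proof (induction es arbitrary: B u v rule: rev_induct)
  case Nil
  then show ?case using \<open>refl R\<close> by (auto simp: components_def refl_on_def)
next
  case (snoc e es)
  have IH: "(u, v) \<in> R" if "B \<in> set (components vs es)" "u \<in> set B" "v \<in> set B" for B u v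
    using snoc that by auto
  have e: "(fst e, snd e) \<in> R" using snoc by auto
  then have e': "(snd e, fst e) \<in> R" using \<open>sym R\<close> by (meson symD)
  have *: "(u, fst e) \<in> R" if "B \<in> set (components vs es)" "u \<in> set B" "fst e \<in> set B \<or> snd e \<in> set B" for B u
    using that IH e' \<open>trans R\<close> by (meson transD)
  show ?case
  proof (cases "B \<in> set (components vs es)")
    case True
    then show ?thesis using IH snoc by auto
  next
    case False
    then have "(u, fst e) \<in> R" "(v, fst e) \<in> R"
      using snoc(2-4) * by (auto simp: components_snoc merge_blocks_def)
    then show ?thesis using \<open>sym R\<close> \<open>trans R\<close> by (meson symD transD)
  qed
qed

text \<open>
  Later merges only enlarge blocks, so the two ends of an edge stay together once it was processed;
  this bounds the components from below.
\<close>

lemma components_closed: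
  assumes "e \<in> set es" "fst ` set es \<subseteq> set vs" "snd ` set es \<subseteq> set vs"
  shows "\<exists>B\<in>set (components vs es). fst e \<in> set B \<and> snd e \<in> set B"
  using assms
proof (induction es rule: rev_induct)
  case (snoc e' es)
  have coarser: "\<exists>C\<in>set (merge_blocks e' bs). set B \<subseteq> set C" if "B \<in> set bs" for B :: "'a list" and bs
    using that by (cases "fst e' \<in> set B \<or> snd e' \<in> set B") (auto simp: merge_blocks_def)
  show ?case
  proof (cases "e \<in> set es")
    case True
    then obtain B where "B \<in> set (components vs es)" "fst e \<in> set B \<and> snd e \<in> set B"
      using snoc by auto
    then show ?thesis using coarser[of B "components vs es"] by (auto simp: components_snoc)
  next
    case False
    have cover: "\<exists>B\<in>set (components vs es). v \<in> set B" if "v \<in> set vs" for v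
    proof -
      have "\<exists>B\<in>set (fold merge_blocks es bs). v \<in> set B" if "\<exists>B\<in>set bs. v \<in> set B" for bs
        using that
      proof (induction es arbitrary: bs)
        case (Cons e es)
        have "\<exists>B\<in>set (merge_blocks e bs). v \<in> set B"
          using Cons.prems by (auto simp: merge_blocks_def)
        then show ?case using Cons.IH by simp
      qed simp
      then show ?thesis using that by (simp add: components_def)
    qed
    have "e = e'" using False snoc by auto
    then show ?thesis using snoc.prems cover[of "fst e"] cover[of "snd e"]
      by (auto simp: components_snoc merge_blocks_def)
  qed
qed simp

lemma components_class:
  assumes "distinct vs" "fst ` set es \<subseteq> set vs" "snd ` set es \<subseteq> set vs"
    and "B \<in> set (components vs es)" "v \<in> set B"
  shows "(set es \<union> (set es)\<inverse>)\<^sup>* `` {v} = set B"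
proof
  let ?R = "set es \<union> (set es)\<inverse>"
  have "sym ?R" by (auto simp: sym_def)
  then have "sym (?R\<^sup>*)" by (rule sym_rtrancl)
  then show "set B \<subseteq> ?R\<^sup>* `` {v}"
    using components_sound[OF assms(4,5), of _ "?R\<^sup>*"] by (auto simp: refl_rtrancl trans_rtrancl)
  have "w \<in> set B" if "(v, w) \<in> ?R\<^sup>*" for w
    using that
  proof induction
    case base
    then show ?case by (fact assms)
  next
    case (step y z)
    then obtain C where C: "C \<in> set (components vs es)" "y \<in> set C" "z \<in> set C"
      using components_closed[of "(y, z)" es vs] components_closed[of "(z, y)" es vs] assms(2,3) by auto
    then have "C = B"
      using partition_list_unique[OF partition_components[OF assms(1,2)], of C B y] step assms(4) by auto
    then show ?case using C by simp
  qed
  then show "?R\<^sup>* `` {v} \<subseteq> set B" by auto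
qed

lemma components_classes:
  assumes "distinct vs" "fst ` set es \<subseteq> set vs" "snd ` set es \<subseteq> set vs"
  shows "(\<lambda>v. (set es \<union> (set es)\<inverse>)\<^sup>* `` {v}) ` set vs = set ` set (components vs es)"
proof -
  have p: "partition_list (set vs) (components vs es)"
    using assms by (intro partition_components)
  show ?thesis
  proof (intro equalityI subsetI)
    fix X assume "X \<in> (\<lambda>v. (set es \<union> (set es)\<inverse>)\<^sup>* `` {v}) ` set vs"
    then obtain v where v: "v \<in> set vs" "X = (set es \<union> (set es)\<inverse>)\<^sup>* `` {v}" by auto
    then obtain B where "B \<in> set (components vs es)" "v \<in> set B"
      using p by (auto simp: partition_list_def)
    then show "X \<in> set ` set (components vs es)" using components_class[OF assms] v by auto
  next
    fix X assume "X \<in> set ` set (components vs es)"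
    then obtain B where B: "B \<in> set (components vs es)" "X = set B" by auto
    then have "B \<noteq> []" using p by (auto simp: partition_list_def)
    then have "hd B \<in> set B" by simp
    moreover have "hd B \<in> set vs" using p B \<open>hd B \<in> set B\<close> unfolding partition_list_def by auto
    ultimately show "X \<in> (\<lambda>v. (set es \<union> (set es)\<inverse>)\<^sup>* `` {v}) ` set vs"
      using components_class[OF assms B(1)] B(2) by auto
  qed
qed

lemma card_components:
  assumes "distinct vs" "fst ` set es \<subseteq> set vs"
  shows "card (set ` set (components vs es)) = length (components vs es)"
  using partition_list_distinct[OF partition_components[OF assms]]
  by (metis distinct_card length_map list.set_map)

text \<open>
  The data of a tangle as lists. The closed strings are given as a separate list \<open>ls\<close>, because a
  multiset has no preferred enumeration.
\<close>

definition disc_list :: "tangle \<Rightarrow> nat list" where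
  "disc_list T = sorted_list_of_set (discs T)"

definition point_list :: "tangle \<Rightarrow> point list" where
  "point_list T = concat (map (\<lambda>d. map (Pair d) [0..<2 * bpts T d]) (0 # disc_list T))"

definition interval_list :: "tangle \<Rightarrow> point list" where
  "interval_list T = concat (map (\<lambda>d. map (Pair d) [0..<max 1 (2 * bpts T d)]) (0 # disc_list T))"

definition region_list :: "(region \<times> region) list \<Rightarrow> tangle \<Rightarrow> region list" where
  "region_list ls T = remdups (map (reg T) (interval_list T) @ map fst ls @ map snd ls)"

definition shaded_list :: "(region \<times> region) list \<Rightarrow> tangle \<Rightarrow> region list" where
  "shaded_list ls T =
     map (reg T) (filter (\<lambda>(d, j). unshaded T d \<noteq> even j) (interval_list T)) @ map snd ls"

text \<open>
  The clauses follow those of \<^const>\<open>is_tangle\<close>. A shading, if there is one, is determined by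
  the intervals and the closed strings, so it suffices to test the candidate \<^term>\<open>shaded_list ls T\<close>.
  Connectedness is tested with fewer adjacencies than \<^const>\<open>region_adj\<close> contains: every interval
  is compared with the marked one of its disc, which generates the same equivalence relation.
\<close>

definition check_tangle :: "(region \<times> region) list \<Rightarrow> tangle \<Rightarrow> bool" where
  "check_tangle ls T \<longleftrightarrow>
    discs T = set (disc_list T) \<and> 0 \<notin> discs T \<and> loops T = mset ls \<and>
    list_all (\<lambda>p. mate T p \<in> set (point_list T) \<and> mate T p \<noteq> p \<and> mate T (mate T p) = p \<and>
      reg T (left_of T p) = reg T (right_of T (mate T p))) (point_list T) \<and>
    (let sh = shaded_list ls T in
      list_all (\<lambda>(d, j). reg T (d, j) \<in> set sh \<longleftrightarrow> unshaded T d \<noteq> even j) (interval_list T) \<and>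
      list_all (\<lambda>(u, v). u \<notin> set sh) ls) \<and>
    length (components (region_list ls T)
      (map (\<lambda>(d, j). (reg T (d, 0), reg T (d, j))) (interval_list T) @ ls)) = 1 \<and>
    length (0 # disc_list T) + 2 * length (region_list ls T) =
      2 + sum_list (map (bpts T) (0 # disc_list T)) +
      length (components (interval_list T)
        (map (\<lambda>p. (left_of T p, right_of T (mate T p))) (point_list T))) +
      2 * length ls"

lemma check_tangle_discs:
  assumes "check_tangle ls T"
  shows "set (disc_list T) = discs T" "distinct (0 # disc_list T)" "0 \<notin> discs T"
    "set (point_list T) = points T" "distinct (point_list T)"
    "set (interval_list T) = intervals T" "distinct (interval_list T)"
    "set (region_list ls T) = regions T" "loops T = mset ls"
proof -
  have "discs T = set (disc_list T)" and 0: "0 \<notin> discs T" and ls: "loops T = mset ls"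
    using assms unfolding check_tangle_def by blast+
  from this(1) show discs: "set (disc_list T) = discs T" by (rule sym)
  show dist: "distinct (0 # disc_list T)"
    using 0 discs by (simp only: distinct.simps simp_thms) (simp add: disc_list_def)
  show "0 \<notin> discs T" "loops T = mset ls" by fact+
  show "set (point_list T) = points T"
    using discs by (auto simp: point_list_def points_def)
  show ivs: "set (interval_list T) = intervals T"
    using discs by (auto simp: interval_list_def intervals_def)
  have *: "distinct (concat (map (\<lambda>d. map (Pair d) [0..<f d]) ds))" if "distinct ds" for ds and f :: "nat \<Rightarrow> nat"
    using that by (induction ds) (auto simp: distinct_map inj_on_def)
  show "distinct (point_list T)" "distinct (interval_list T)"
    unfolding point_list_def interval_list_def by (intro * dist)+
  show "set (region_list ls T) = regions T"
    by (simp add: region_list_def regions_def ivs ls Un_assoc)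
qed

lemma sides_in_intervals:
  assumes "p \<in> points T"
  shows "left_of T p \<in> intervals T" "right_of T p \<in> intervals T"
  using assms by (auto simp: points_def intervals_def left_of_def right_of_def)

lemma check_tangle_sound:
  assumes "check_tangle ls T"
  shows "is_tangle T"
proof -
  note l = check_tangle_discs[OF assms]
  have mates: "mate T p \<in> points T \<and> mate T p \<noteq> p \<and> mate T (mate T p) = p \<and>
      reg T (left_of T p) = reg T (right_of T (mate T p))" if "p \<in> points T" for p
  proof -
    have "list_all (\<lambda>p. mate T p \<in> set (point_list T) \<and> mate T p \<noteq> p \<and> mate T (mate T p) = p \<and>
        reg T (left_of T p) = reg T (right_of T (mate T p))) (point_list T)"
      using assms unfolding check_tangle_def by (elim conjE)
    then show ?thesis using that unfolding list_all_iff l(4) by blast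
  qed
  let ?sh = "set (shaded_list ls T)"
  have shading: "\<forall>(d, j)\<in>intervals T. reg T (d, j) \<in> ?sh \<longleftrightarrow> unshaded T d \<noteq> even j"
  proof -
    have "list_all (\<lambda>(d, j). reg T (d, j) \<in> ?sh \<longleftrightarrow> unshaded T d \<noteq> even j) (interval_list T)"
      using assms unfolding check_tangle_def Let_def by (elim conjE)
    then show ?thesis unfolding list_all_iff l(6) .
  qed
  have "list_all (\<lambda>(u, v). u \<notin> ?sh) ls"
    using assms unfolding check_tangle_def Let_def by (elim conjE)
  then have shading': "\<forall>(u, v)\<in>set_mset (loops T). u \<notin> ?sh \<and> v \<in> ?sh"
    by (auto simp: l(9) list_all_iff shaded_list_def intro: rev_image_eqI)
  have conn: "(r, r') \<in> (region_adj T)\<^sup>*" if "r \<in> regions T" "r' \<in> regions T" for r r'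
  proof -
    let ?es = "map (\<lambda>(d, j). (reg T (d, 0), reg T (d, j))) (interval_list T) @ ls"
    have "(d, 0) \<in> intervals T" if "(d, j) \<in> intervals T" for d j
      using that by (auto simp: intervals_def)
    then have sub: "set ?es \<subseteq> region_adj T"
    proof -
      have "(\<lambda>(d, j). (reg T (d, 0), reg T (d, j))) ` intervals T \<subseteq> region_adj T"
        using \<open>\<And>d j. (d, j) \<in> intervals T \<Longrightarrow> (d, 0) \<in> intervals T\<close>
        unfolding region_adj_def by fast
      moreover have "set ls \<subseteq> region_adj T" by (auto simp: region_adj_def l(9))
      ultimately show ?thesis by (simp only: set_append set_map l(6) Un_least)
    qed
    have "sym (region_adj T)"
    proof (rule symI)
      fix a b assume "(a, b) \<in> region_adj T"
      then show "(b, a) \<in> region_adj T" unfolding region_adj_def by blast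
    qed
    then have "sym ((region_adj T)\<^sup>*)" by (rule sym_rtrancl)
    have "length (components (region_list ls T) ?es) = 1"
      using assms unfolding check_tangle_def by (elim conjE)
    then obtain B where B: "components (region_list ls T) ?es = [B]"
      by (cases "components (region_list ls T) ?es") simp_all
    have "distinct (region_list ls T)" by (simp add: region_list_def)
    moreover have "fst ` set ?es \<subseteq> set (region_list ls T)"
    proof -
      have "reg T (d, 0) \<in> regions T" if "(d, j) \<in> intervals T" for d j
        using that \<open>\<And>d j. (d, j) \<in> intervals T \<Longrightarrow> (d, 0) \<in> intervals T\<close> unfolding regions_def by blast
      moreover have "fst ` set ls \<subseteq> regions T" by (auto simp: regions_def l(9))
      ultimately show ?thesis unfolding l(8) set_append set_map l(6) by force
    qed
    ultimately have "partition_list (regions T) (components (region_list ls T) ?es)"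
      unfolding l(8)[symmetric] by (rule partition_components)
    then have "regions T = set B" unfolding B by (simp add: partition_list_def)
    then have "r \<in> set B" "r' \<in> set B" using that by auto
    moreover have "B \<in> set (components (region_list ls T) ?es)" unfolding B by simp
    moreover have "set ?es \<subseteq> (region_adj T)\<^sup>*" using sub by blast
    ultimately show ?thesis
      by (intro components_sound[where es = ?es and B = B] \<open>sym ((region_adj T)\<^sup>*)\<close> refl_rtrancl trans_rtrancl)
  qed
  let ?st = "map (\<lambda>p. (left_of T p, right_of T (mate T p))) (point_list T)"
  have st: "set ?st = side_step T" by (simp add: side_step_def l)
  have st': "fst ` set ?st \<subseteq> set (interval_list T)" "snd ` set ?st \<subseteq> set (interval_list T)"
    unfolding set_map l(4,6) image_image fst_conv snd_conv using mates sides_in_intervals by blast+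
  have "boundary_cycles T = set ` set (components (interval_list T) ?st)"
    using components_classes[OF l(7) st'] unfolding boundary_cycles_def st l(6) .
  then have "card (boundary_cycles T) = length (components (interval_list T) ?st)"
    using card_components[OF l(7) st'(1)] by simp
  moreover have "card (insert 0 (discs T)) = length (0 # disc_list T)"
    using l(1) distinct_card[OF l(2)] by simp
  moreover have "card (regions T) = length (region_list ls T)"
    using l(8) distinct_card[of "region_list ls T"] by (simp add: region_list_def)
  moreover have "(\<Sum>d\<in>insert 0 (discs T). bpts T d) = sum_list (map (bpts T) (0 # disc_list T))"
    using sum.distinct_set_conv_list[OF l(2), of "bpts T"] l(1) by simp
  moreover have "size (loops T) = length ls" using l(9) by simp
  moreover have "length (0 # disc_list T) + 2 * length (region_list ls T) =
      2 + sum_list (map (bpts T) (0 # disc_list T)) + length (components (interval_list T) ?st) + 2 * length ls"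
    using assms unfolding check_tangle_def by (elim conjE)
  ultimately have euler: "card (insert 0 (discs T)) + 2 * card (regions T) =
       2 + (\<Sum>d\<in>insert 0 (discs T). bpts T d) + card (boundary_cycles T) + 2 * size (loops T)"
    by linarith
  have "finite (discs T)" using l(1) by (metis finite_set)
  moreover have "\<exists>shaded. (\<forall>(d, j)\<in>intervals T. reg T (d, j) \<in> shaded \<longleftrightarrow> unshaded T d \<noteq> even j) \<and>
      (\<forall>(u, v)\<in>set_mset (loops T). u \<notin> shaded \<and> v \<in> shaded)"
    by (intro exI[of _ ?sh] conjI shading shading')
  moreover have "\<forall>p\<in>points T. mate T p \<in> points T \<and> mate T p \<noteq> p \<and> mate T (mate T p) = p"
    "\<forall>p\<in>points T. reg T (left_of T p) = reg T (right_of T (mate T p))"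
    "\<forall>r\<in>regions T. \<forall>r'\<in>regions T. (r, r') \<in> (region_adj T)\<^sup>*"
    using mates conn by blast+
  ultimately show ?thesis
    unfolding is_tangle_def using l(3) euler by (intro conjI)
qed

text \<open>
  Here the renamings \<open>\<sigma>\<close> of discs and \<open>\<rho>\<close> of regions are supplied as certificates. The closed
  strings of the two tangles have to be listed in matching order.
\<close>

definition check_isotopic :: "(nat \<Rightarrow> nat) \<Rightarrow> (region \<Rightarrow> region) \<Rightarrow> (region \<times> region) list \<Rightarrow> tangle \<Rightarrow>
    (region \<times> region) list \<Rightarrow> tangle \<Rightarrow> bool" where
  "check_isotopic \<sigma> \<rho> ls T ls' T' \<longleftrightarrow>
     check_tangle ls T \<and> check_tangle ls' T' \<and>
     \<sigma> 0 = 0 \<and> set (map \<sigma> (disc_list T)) = set (disc_list T') \<and> distinct (map \<sigma> (disc_list T)) \<and>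
     list_all (\<lambda>d. bpts T' (\<sigma> d) = bpts T d \<and> unshaded T' (\<sigma> d) = unshaded T d) (0 # disc_list T) \<and>
     list_all (\<lambda>p. mate T' (map_prod \<sigma> id p) = map_prod \<sigma> id (mate T p)) (point_list T) \<and>
     distinct (map \<rho> (region_list ls T)) \<and>
     list_all (\<lambda>I. reg T' (map_prod \<sigma> id I) = \<rho> (reg T I)) (interval_list T) \<and>
     ls' = map (map_prod \<rho> \<rho>) ls"

lemma check_isotopic_sound:
  assumes "check_isotopic \<sigma> \<rho> ls T ls' T'"
  shows "is_tangle T" "is_tangle T'" "isotopic \<sigma> T T'"
proof -
  have T: "check_tangle ls T" and T': "check_tangle ls' T'" and 0: "\<sigma> 0 = 0"
    and im: "set (map \<sigma> (disc_list T)) = set (disc_list T')" and inj: "distinct (map \<sigma> (disc_list T))"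
    and types: "list_all (\<lambda>d. bpts T' (\<sigma> d) = bpts T d \<and> unshaded T' (\<sigma> d) = unshaded T d) (0 # disc_list T)"
    and mates: "list_all (\<lambda>p. mate T' (map_prod \<sigma> id p) = map_prod \<sigma> id (mate T p)) (point_list T)"
    and inj': "distinct (map \<rho> (region_list ls T))"
    and regs: "list_all (\<lambda>I. reg T' (map_prod \<sigma> id I) = \<rho> (reg T I)) (interval_list T)"
    and ls: "ls' = map (map_prod \<rho> \<rho>) ls"
    using assms unfolding check_isotopic_def by blast+
  note l = check_tangle_discs[OF T] and l' = check_tangle_discs[OF T']
  show "is_tangle T" "is_tangle T'" using T T' by (auto intro: check_tangle_sound)
  have "bij_betw \<sigma> (discs T) (discs T')"
    using im inj by (simp add: bij_betw_def distinct_map l(1) l'(1))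
  moreover have "inj_on \<rho> (regions T)"
    using inj' by (simp only: distinct_map l(8))
  moreover have "loops T' = image_mset (map_prod \<rho> \<rho>) (loops T)"
    by (simp add: l(9) l'(9) ls)
  ultimately show "isotopic \<sigma> T T'"
    using 0 types mates regs unfolding isotopic_def list_all_iff l(4,6) list.set l(1) by blast
qed

text \<open>
  Composition requires disjoint labels of input discs. Raising all nonzero labels by \<open>k\<close>
  achieves this and is an isotopy in the sense of \<^const>\<open>isotopic\<close>.
\<close>

definition shift :: "nat \<Rightarrow> tangle \<Rightarrow> tangle" where
  "shift k T =
     (let up = (\<lambda>d. if d = 0 then 0 else d + k); dn = (\<lambda>d. d - k)
      in T\<lparr>discs := up ` discs T, bpts := bpts T \<circ> dn, unshaded := unshaded T \<circ> dn,
           mate := map_prod up id \<circ> mate T \<circ> map_prod dn id, reg := reg T \<circ> map_prod dn id\<rparr>)"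

lemma isotopic_shift:
  "isotopic (\<lambda>d. if d = 0 then 0 else d + k) T (shift k T)"
proof -
  have "inj_on (\<lambda>d. if d = 0 then 0 else d + k) (discs T)"
    by (auto simp: inj_on_def split: if_splits)
  then show ?thesis
    unfolding isotopic_def
    by (auto simp: shift_def Let_def map_prod_def bij_betw_def split: prod.splits
        intro!: exI[of _ id])
qed

text \<open>
  A string of \<open>T\<close> has reached the point \<open>p\<close>. If \<open>p\<close> lies on the disc \<open>i\<close> where \<open>S\<close> is inserted, the
  string continues inside \<open>S\<close>; it either ends at an input disc of \<open>S\<close> or leaves \<open>S\<close> again and
  continues in \<open>T\<close>. The number of crossings is bounded by the number of points on the erased circle,
  whence the first argument.
\<close>

fun follow :: "nat \<Rightarrow> tangle \<Rightarrow> nat \<Rightarrow> tangle \<Rightarrow> point \<Rightarrow> point" where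
  "follow 0 T i S p = p"
| "follow (Suc k) T i S p =
     (if fst p \<noteq> i then p
      else let q = mate S (0, snd p)
           in if fst q \<noteq> 0 then q else follow k T i S (mate T (i, snd q)))"

text \<open>
  The composite of \<open>T\<close> and \<open>S\<close>, computed. The maps \<open>f\<close> and \<open>g\<close> name the regions of the composite
  and \<open>ls\<close> lists its closed strings; both are certificates that \<open>check_glue\<close> below verifies.
\<close>

definition glue :: "tangle \<Rightarrow> nat \<Rightarrow> tangle \<Rightarrow> (region \<Rightarrow> region) \<Rightarrow> (region \<Rightarrow> region) \<Rightarrow>
    (region \<times> region) list \<Rightarrow> tangle" where
  "glue T i S f g ls = \<lparr>discs = (discs T - {i}) \<union> discs S,
     bpts = (\<lambda>d. if d \<in> discs S then bpts S d else bpts T d),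
     unshaded = (\<lambda>d. if d \<in> discs S then unshaded S d else unshaded T d),
     mate = (\<lambda>p. if fst p \<in> discs S
       then (let q = mate S p in if fst q \<noteq> 0 then q else follow (2 * bpts T i) T i S (mate T (i, snd q)))
       else follow (2 * bpts T i) T i S (mate T p)),
     reg = (\<lambda>p. if fst p \<in> discs S then g (reg S p) else f (reg T p)), loops = mset ls\<rparr>"

definition glued_list :: "tangle \<Rightarrow> nat \<Rightarrow> tangle \<Rightarrow> (point \<times> point) list" where
  "glued_list T i S =
     (let \<iota> = map_prod (\<lambda>d. if d = 0 then i else d) id
      in map (\<lambda>p. (p, mate T p)) (point_list T) @ map (\<lambda>p. (\<iota> p, \<iota> (mate S p))) (point_list S))"

definition check_glue :: "(region \<times> region) list \<Rightarrow> (region \<times> region) list \<Rightarrow> (region \<times> region) list \<Rightarrow>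
    (region \<Rightarrow> region) \<Rightarrow> (region \<Rightarrow> region) \<Rightarrow> tangle \<Rightarrow> nat \<Rightarrow> tangle \<Rightarrow> bool" where
  "check_glue lT lS lU f g T i S \<longleftrightarrow>
     check_tangle lT T \<and> check_tangle lS S \<and> check_tangle lU (glue T i S f g lU) \<and>
     i \<in> discs T \<and> list_all (\<lambda>d. d \<notin> discs S) (disc_list T) \<and>
     bpts S 0 = bpts T i \<and> unshaded S 0 = unshaded T i \<and>
     list_all (\<lambda>j. f (reg T (i, j)) = g (reg S (0, j))) [0..<max 1 (2 * bpts T i)] \<and>
     (let es = glued_list T i S; cs = components (remdups (map fst es)) es;
          nl = filter (list_all (\<lambda>p. fst p = i)) cs
      in list_all (\<lambda>e. (snd e, fst e) \<in> set es) es \<and>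
         list_all (\<lambda>p. list_ex (\<lambda>C. p \<in> set C \<and> mate (glue T i S f g lU) p \<in> set C) cs)
           (point_list (glue T i S f g lU)) \<and>
         list_all (\<lambda>C. list_all (\<lambda>p. map_prod f f (sides T p) = map_prod f f (sides T (hd C))) C) nl \<and>
         lU = map (map_prod f f) lT @ map (map_prod g g) lS @ map (\<lambda>C. map_prod f f (sides T (hd C))) nl)"

text \<open>
  The components of the glued strings decide both what the strings of the composite are and which
  closed strings are new: those are the components that never leave the erased circle. As the glued
  strings form a symmetric relation, its reflexive transitive closure is the component relation.
\<close>

lemma check_glue_sound:
  assumes "check_glue lT lS lU f g T i S"
  shows "is_composite T i S (glue T i S f g lU)"
proof -
  define U where "U = glue T i S f g lU"
  define es where "es = glued_list T i S"
  define cs where "cs = components (remdups (map fst es)) es"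
  define nl where "nl = filter (list_all (\<lambda>p. fst p = i)) cs"
  have T: "check_tangle lT T" and S: "check_tangle lS S" and U: "check_tangle lU U"
    and i: "i \<in> discs T" and disj: "list_all (\<lambda>d. d \<notin> discs S) (disc_list T)"
    and type: "bpts S 0 = bpts T i" "unshaded S 0 = unshaded T i"
    and circle: "list_all (\<lambda>j. f (reg T (i, j)) = g (reg S (0, j))) [0..<max 1 (2 * bpts T i)]"
    and symm: "list_all (\<lambda>e. (snd e, fst e) \<in> set es) es"
    and mates: "list_all (\<lambda>p. list_ex (\<lambda>C. p \<in> set C \<and> mate U p \<in> set C) cs) (point_list U)"
    and const: "list_all (\<lambda>C. list_all (\<lambda>p. map_prod f f (sides T p) = map_prod f f (sides T (hd C))) C) nl"
    and lU: "lU = map (map_prod f f) lT @ map (map_prod g g) lS @ map (\<lambda>C. map_prod f f (sides T (hd C))) nl"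
    using assms unfolding check_glue_def Let_def U_def es_def cs_def nl_def by blast+
  note lT = check_tangle_discs[OF T] and lS = check_tangle_discs[OF S] and lU' = check_tangle_discs[OF U]
  have disj': "discs T \<inter> discs S = {}"
    using disj unfolding list_all_iff lT(1) by auto
  have i0: "i \<noteq> 0" "i \<notin> discs S" using i lT(3) disj' by auto
  have 0: "0 \<notin> discs S" by (fact lS(3))
  have es: "glued_strings T i S = set es"
    by (simp add: glued_strings_def es_def glued_list_def Let_def lT(4) lS(4))
  let ?R = "glued_strings T i S"
  have "set es = (set es)\<inverse>" using symm by (force simp: list_all_iff)
  then have R: "set es \<union> (set es)\<inverse> = ?R" unfolding es by blast
  have dist: "distinct (remdups (map fst es))" by simp
  have sub1: "fst ` set es \<subseteq> set (remdups (map fst es))" by simp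
  have sub2: "snd ` set es \<subseteq> set (remdups (map fst es))"
    using symm by (force simp: list_all_iff)
  have part: "partition_list (fst ` set es) cs"
    using partition_components[OF dist sub1] by (simp add: cs_def)
  have cls: "?R\<^sup>* `` {v} = set C" if "C \<in> set cs" "v \<in> set C" for C v
    using components_class[OF dist sub1 sub2] that unfolding R cs_def by blast
  have mates': "(p, mate U p) \<in> ?R\<^sup>*" if p: "p \<in> points U" for p
  proof -
    obtain C where "C \<in> set cs" "p \<in> set C" "mate U p \<in> set C"
      using p mates unfolding list_all_iff list_ex_iff lU'(4) by blast
    then show ?thesis using cls by blast
  qed
  have nl_sub: "C \<in> set cs" "C \<noteq> []" "set C \<subseteq> {i} \<times> UNIV" if "C \<in> set nl" for C
    using that part by (auto simp: nl_def partition_list_def list_all_iff)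
  have new: "new_loops T i S = set ` set nl"
  proof (intro equalityI subsetI)
    fix C assume "C \<in> new_loops T i S"
    then obtain j where j: "j < 2 * bpts T i" "C = ?R\<^sup>* `` {(i, j)}" "C \<subseteq> {i} \<times> UNIV"
      by (auto simp: new_loops_def)
    then have "(i, j) \<in> points T" using i by (auto simp: points_def)
    then have "((i, j), mate T (i, j)) \<in> set es" unfolding es[symmetric] by (auto simp: glued_strings_def Let_def)
    then have "(i, j) \<in> fst ` set es" by force
    then obtain B where B: "B \<in> set cs" "(i, j) \<in> set B" using part by (auto simp: partition_list_def)
    then have "C = set B" using cls j by blast
    then show "C \<in> set ` set nl" using B j(3) by (force simp: nl_def list_all_iff)
  next
    fix C assume "C \<in> set ` set nl"
    then obtain B where B: "B \<in> set nl" "C = set B" by auto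
    note B' = nl_sub[OF B(1)]
    have "hd B \<in> set B" using B'(2) by simp
    then obtain j where j: "(i, j) \<in> set B" using B'(3) by (metis mem_Sigma_iff singletonD prod.collapse subsetD)
    then have "(i, j) \<in> fst ` set es" using B'(1) part by (auto simp: partition_list_def)
    then have "(i, j) \<in> points T \<or> (\<exists>p\<in>points S. (i, j) = map_prod (\<lambda>d. if d = 0 then i else d) id p)"
      unfolding es[symmetric] glued_strings_def Let_def by force
    then have "j < 2 * bpts T i"
      using i0 type by (auto simp: points_def split: if_splits)
    moreover have "C = ?R\<^sup>* `` {(i, j)}" using cls[OF B'(1) j] B(2) by simp
    ultimately show "C \<in> new_loops T i S" using B'(3) B(2) unfolding new_loops_def by blast
  qed
  have "distinct (map set nl)"
    using partition_list_distinct[OF part] by (simp add: nl_def distinct_map_filter)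
  then have "mset_set (set ` set nl) = mset (map set nl)"
    by (metis list.set_map mset_set_set)
  moreover have "the_elem ((map_prod f f \<circ> sides T) ` set C) = map_prod f f (sides T (hd C))"
    if "C \<in> set nl" for C
  proof -
    have "map_prod f f (sides T p) = map_prod f f (sides T (hd C))" if "p \<in> set C" for p
      using const that \<open>C \<in> set nl\<close> unfolding list_all_iff by blast
    moreover have "hd C \<in> set C" using nl_sub(2)[OF that] by simp
    ultimately have "(map_prod f f \<circ> sides T) ` set C = {map_prod f f (sides T (hd C))}"
      unfolding o_def by blast
    then show ?thesis by simp
  qed
  ultimately have "image_mset (\<lambda>C. the_elem ((map_prod f f \<circ> sides T) ` C)) (mset_set (new_loops T i S)) =
      mset (map (\<lambda>C. map_prod f f (sides T (hd C))) nl)"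
    unfolding new by (simp add: multiset.map_comp) (intro image_mset_cong, simp)
  then have loops: "loops U = image_mset (map_prod f f) (loops T) + image_mset (map_prod g g) (loops S) +
      image_mset (\<lambda>C. the_elem ((map_prod f f \<circ> sides T) ` C)) (mset_set (new_loops T i S))"
    using lU by (simp add: lU'(9) lT(9) lS(9))
  have circle': "\<forall>(d, j)\<in>intervals T. d = i \<longrightarrow> f (reg T (i, j)) = g (reg S (0, j))"
    using circle by (auto simp: list_all_iff intervals_def)
  have regT: "\<forall>(d, j)\<in>intervals T. d \<noteq> i \<longrightarrow> reg U (d, j) = f (reg T (d, j))"
    using disj' 0 by (auto simp: U_def glue_def intervals_def)
  have regS: "\<forall>(d, j)\<in>intervals S. d \<noteq> 0 \<longrightarrow> reg U (d, j) = g (reg S (d, j))"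
    by (auto simp: U_def glue_def intervals_def)
  have bT: "bpts U d = bpts T d" "unshaded U d = unshaded T d" if "d \<in> insert 0 (discs T - {i})" for d
    using that disj' 0 by (auto simp: U_def glue_def)
  have bS: "d \<in> discs S \<Longrightarrow> bpts U d = bpts S d" "d \<in> discs S \<Longrightarrow> unshaded U d = unshaded S d" "discs U = (discs T - {i}) \<union> discs S" for d
    by (auto simp: U_def glue_def)
  have "\<exists>f g. (\<forall>(d, j)\<in>intervals T. d = i \<longrightarrow> f (reg T (i, j)) = g (reg S (0, j))) \<and>
      (\<forall>(d, j)\<in>intervals T. d \<noteq> i \<longrightarrow> reg U (d, j) = f (reg T (d, j))) \<and>
      (\<forall>(d, j)\<in>intervals S. d \<noteq> 0 \<longrightarrow> reg U (d, j) = g (reg S (d, j))) \<and>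
      loops U = image_mset (map_prod f f) (loops T) + image_mset (map_prod g g) (loops S) +
        image_mset (\<lambda>C. the_elem ((map_prod f f \<circ> sides T) ` C)) (mset_set (new_loops T i S))"
    by (rule exI[of _ f], rule exI[of _ g], intro conjI circle' regT regS loops)
  moreover have "\<forall>d\<in>insert 0 (discs T - {i}). bpts U d = bpts T d \<and> unshaded U d = unshaded T d"
    "\<forall>d\<in>discs S. bpts U d = bpts S d \<and> unshaded U d = unshaded S d"
    "\<forall>p\<in>points U. (p, mate U p) \<in> ?R\<^sup>*"
    using bT bS mates' by blast+
  ultimately show ?thesis
    unfolding U_def[symmetric] is_composite_def
    using check_tangle_sound[OF T] check_tangle_sound[OF S] check_tangle_sound[OF U] i disj' type bS(3)
    by (intro conjI)
qed

section \<open>Identities between particular tangles\<close>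

text \<open>
  Each lemma of this section records that two ways of drawing a picture agree. The arguments
  \<^term>\<open>rename xs\<close> are the identifications of discs and regions, read off from the drawings; the
  verification is a finite computation, separate for the two shadings.
\<close>

definition rename :: "('b \<times> 'b) list \<Rightarrow> 'b \<Rightarrow> 'b" where
  "rename xs r = (case map_of xs r of None \<Rightarrow> r | Some r' \<Rightarrow> r')"

text \<open>
  The (unshaded, shaded) pair of sides of a closed string, if \<open>s\<close> says that \<open>a\<close> is unshaded.
\<close>

definition oriented :: "bool \<Rightarrow> 'b \<Rightarrow> 'b \<Rightarrow> 'b \<times> 'b" where
  "oriented s a b = (if s then (a, b) else (b, a))"

text \<open>
  A closed string around an input disc without boundary points.
\<close>

definition ring_tangle :: "bool \<Rightarrow> tangle" where
  "ring_tangle s = \<lparr>discs = {1}, bpts = (\<lambda>_. 0), unshaded = (\<lambda>d. if d = 0 then s else \<not> s),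
     mate = id, reg = (\<lambda>(d, j). (0, d)), loops = {#oriented s (0, 0) (0, 1)#}\<rparr>"

lemma check_unit:
  "check_tangle [] (unit_tangle 0 s)" "check_tangle [] (unit_tangle 1 s)" "check_tangle [] (unit_tangle 2 s)"
  by (induct s; code_simp)+

lemma check_mult:
  "check_tangle [] (mult_tangle 0 s)" "check_tangle [] (mult_tangle 1 s)" "check_tangle [] (mult_tangle 2 s)"
  by (induct s; code_simp)+

lemma check_trace: 
  "check_tangle [] (trace_tangle 1 s)" "check_tangle [] (trace_tangle 2 s)"
  by (induct s; code_simp)+

lemma check_loop: "check_tangle [oriented s (0, 0) (0, 1)] (loop_tangle s)"
  by (induct s; code_simp)

lemma check_ring: "check_tangle [oriented s (0, 0) (0, 1)] (ring_tangle s)"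
  by (induct s; code_simp)

lemma check_rotation: 
  "check_tangle [] (rotation_tangle 2 s)" "check_tangle [] (reflect (rotation_tangle 2 s))"
  by (induct s; code_simp)+

lemma reflect_unit: "check_isotopic id id [] (unit_tangle 1 s) [] (reflect (unit_tangle 1 s))"
  by (induct s; code_simp)

lemma reflect_mult:
  "check_isotopic (rename [(1, 2), (2, 1)]) (rename [((0, 1), (0, 3)), ((0, 3), (0, 1))])
     [] (mult_tangle 2 s) [] (reflect (mult_tangle 2 s))"
  by (induct s; code_simp)

abbreviation unit_mult_0 :: "bool \<Rightarrow> tangle" where
  "unit_mult_0 s \<equiv> glue (mult_tangle 0 s) 1 (unit_tangle 0 s) id id []"

lemma unit_mult_0:
  "check_glue [] [] [] id id (mult_tangle 0 s) 1 (unit_tangle 0 s)"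
  "check_isotopic (rename [(1, 2)]) id [] (id_tangle 0 s) [] (unit_mult_0 s)"
  by (induct s; code_simp)+

abbreviation unit_mult_1 :: "bool \<Rightarrow> tangle" where
  "unit_mult_1 s \<equiv> glue (mult_tangle 1 s) 1 (unit_tangle 1 s) id id []"

lemma unit_mult_1:
  "check_glue [] [] [] id id (mult_tangle 1 s) 1 (unit_tangle 1 s)"
  "check_isotopic (rename [(1, 2)]) id [] (id_tangle 1 s) [] (unit_mult_1 s)"
  by (induct s; code_simp)+

abbreviation unit_mult_2 :: "bool \<Rightarrow> tangle" where
  "unit_mult_2 s \<equiv> glue (mult_tangle 2 s) 1 (unit_tangle 2 s) (rename [((1, 3), (0, 1))]) id []"

lemma unit_mult_2:
  "check_glue [] [] [] (rename [((1, 3), (0, 1))]) id (mult_tangle 2 s) 1 (unit_tangle 2 s)"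
  "check_isotopic (rename [(1, 2)]) id [] (id_tangle 2 s) [] (unit_mult_2 s)"
  by (induct s; code_simp)+

abbreviation mult_unit_2 :: "bool \<Rightarrow> tangle" where
  "mult_unit_2 s \<equiv> glue (mult_tangle 2 s) 2 (unit_tangle 2 s)
     (rename [((1, 3), (0, 3))]) (rename [((0, 1), (0, 3))]) []"

lemma mult_unit_2:
  "check_glue [] [] [] (rename [((1, 3), (0, 3))]) (rename [((0, 1), (0, 3))])
     (mult_tangle 2 s) 2 (unit_tangle 2 s)"
  "check_isotopic id id [] (id_tangle 2 s) [] (mult_unit_2 s)"
  by (induct s; code_simp)+

abbreviation mult_mult_left :: "bool \<Rightarrow> tangle" where
  "mult_mult_left s \<equiv> glue (mult_tangle 2 s) 1 (shift 2 (mult_tangle 2 s))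
     id (rename [((0, 3), (1, 3)), ((1, 3), (2, 3))]) []"

abbreviation mult_mult_right :: "bool \<Rightarrow> tangle" where
  "mult_mult_right s \<equiv> glue (mult_tangle 2 s) 2 (shift 2 (mult_tangle 2 s))
     id (rename [((0, 1), (1, 3)), ((1, 3), (2, 3))]) []"

lemma mult_assoc:
  "check_glue [] [] [] id (rename [((0, 3), (1, 3)), ((1, 3), (2, 3))])
     (mult_tangle 2 s) 1 (shift 2 (mult_tangle 2 s))"
  "check_glue [] [] [] id (rename [((0, 1), (1, 3)), ((1, 3), (2, 3))])
     (mult_tangle 2 s) 2 (shift 2 (mult_tangle 2 s))"
  "check_isotopic (rename [(3, 1), (4, 3), (2, 4)]) (rename [((2, 3), (1, 3)), ((1, 3), (2, 3))])
     [] (mult_mult_left s) [] (mult_mult_right s)"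
  by (induct s; code_simp)+

abbreviation trace_unit_1 :: "bool \<Rightarrow> tangle" where
  "trace_unit_1 s \<equiv> glue (trace_tangle 1 s) 1 (unit_tangle 1 s)
     id (rename [((0, 0), (1, 0)), ((0, 1), (1, 1))]) [oriented s (1, 0) (1, 1)]"

lemma trace_unit_1:
  "check_glue [] [] [oriented s (1, 0) (1, 1)] id (rename [((0, 0), (1, 0)), ((0, 1), (1, 1))])
     (trace_tangle 1 s) 1 (unit_tangle 1 s)"
  "check_isotopic id (rename [((1, 0), (0, 0)), ((1, 1), (0, 1))])
     [oriented s (1, 0) (1, 1)] (trace_unit_1 s) [oriented s (0, 0) (0, 1)] (loop_tangle s)"
  by (induct s; code_simp)+

text \<open>
  The trace of the unit of level 2 consists of two nested circles, and so does a circle drawn inside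
  the hole of the ring. The same ring around an empty picture is a single circle.
\<close>

abbreviation trace_unit_2 :: "bool \<Rightarrow> tangle" where
  "trace_unit_2 s \<equiv> glue (trace_tangle 2 s) 1 (unit_tangle 2 s)
     id (rename [((0, 0), (1, 0)), ((0, 1), (1, 1)), ((0, 2), (1, 2))])
     [oriented s (1, 0) (1, 1), oriented s (1, 2) (1, 1)]"

abbreviation ring_loop :: "bool \<Rightarrow> tangle" where
  "ring_loop s \<equiv> glue (ring_tangle s) 1 (loop_tangle (\<not> s))
     id (rename [((0, 0), (0, 1)), ((0, 1), (0, 2))])
     [oriented s (0, 0) (0, 1), oriented s (0, 2) (0, 1)]"

abbreviation ring_unit :: "bool \<Rightarrow> tangle" where
  "ring_unit s \<equiv> glue (ring_tangle s) 1 (unit_tangle 0 (\<not> s))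
     id (rename [((0, 0), (0, 1))]) [oriented s (0, 0) (0, 1)]"

lemma trace_unit_2:
  "check_glue [] [] [oriented s (1, 0) (1, 1), oriented s (1, 2) (1, 1)]
     id (rename [((0, 0), (1, 0)), ((0, 1), (1, 1)), ((0, 2), (1, 2))])
     (trace_tangle 2 s) 1 (unit_tangle 2 s)"
  "check_glue [oriented s (0, 0) (0, 1)] [oriented (\<not> s) (0, 0) (0, 1)]
     [oriented s (0, 0) (0, 1), oriented s (0, 2) (0, 1)]
     id (rename [((0, 0), (0, 1)), ((0, 1), (0, 2))]) (ring_tangle s) 1 (loop_tangle (\<not> s))"
  "check_isotopic id (rename [((1, 0), (0, 0)), ((1, 1), (0, 1)), ((1, 2), (0, 2))])
     [oriented s (1, 0) (1, 1), oriented s (1, 2) (1, 1)] (trace_unit_2 s)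
     [oriented s (0, 0) (0, 1), oriented s (0, 2) (0, 1)] (ring_loop s)"
  by (induct s; code_simp)+

lemma ring_unit:
  "check_glue [oriented s (0, 0) (0, 1)] [] [oriented s (0, 0) (0, 1)]
     id (rename [((0, 0), (0, 1))]) (ring_tangle s) 1 (unit_tangle 0 (\<not> s))"
  "check_isotopic id id [oriented s (0, 0) (0, 1)] (ring_unit s) [oriented s (0, 0) (0, 1)] (loop_tangle s)"
  by (induct s; code_simp)+

text \<open>
  The circle, seen from its inside: the output disc is moved to the other region.
\<close>

abbreviation inside_out_loop :: tangle where
  "inside_out_loop \<equiv> (loop_tangle True)\<lparr>reg := (reg (loop_tangle True))((0, 0) := (0, 1)),
     unshaded := (unshaded (loop_tangle True))(0 := False)\<rparr>"

lemma inside_out_loop: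
  "check_isotopic id (rename [((0, 0), (0, 1)), ((0, 1), (0, 0))])
     [((0, 0), (0, 1))] inside_out_loop [((0, 1), (0, 0))] (loop_tangle False)"
  by code_simp

abbreviation trace_regions :: "region \<Rightarrow> region" where
  "trace_regions \<equiv> rename [((0, 0), (1, 0)), ((0, 1), (1, 1)), ((0, 2), (1, 2)), ((0, 3), (1, 1)), ((1, 3), (2, 3))]"

text \<open>
  The picture of \<open>tr (y x)\<close> consists of two discs joined by four strings, so it is symmetric under
  turning both discs by one click, except that the output disc then lies in a neighbouring
  region. This is what makes the Fourier transform isometric: \<open>rotated_pairing\<close> is the
  picture of the pairing of a rotated and a reflected-rotated disc, \<open>moved_pairing\<close> is the original one
  with the output disc moved, and they agree.
\<close>

abbreviation pairing :: "bool \<Rightarrow> tangle" where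
  "pairing s \<equiv> glue (trace_tangle 2 s) 1 (shift 2 (mult_tangle 2 s)) id trace_regions []"

abbreviation moved_pairing :: "bool \<Rightarrow> tangle" where
  "moved_pairing s \<equiv> (pairing s)\<lparr>reg := (reg (pairing s))((0, 0) := (1, 1)),
     unshaded := (unshaded (pairing s))(0 := \<not> s)\<rparr>"

abbreviation half_rotated_mult :: "bool \<Rightarrow> tangle" where
  "half_rotated_mult s \<equiv> glue (mult_tangle 2 (\<not> s)) 1 (shift 2 (reflect (rotation_tangle 2 s)))
     id (rename [((0, 3), (0, 1)), ((0, 1), (1, 3))]) []"

abbreviation rotated_mult :: "bool \<Rightarrow> tangle" where
  "rotated_mult s \<equiv> glue (half_rotated_mult s) 2 (shift 3 (rotation_tangle 2 s))
     id (rename [((0, 1), (1, 3))]) []"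

abbreviation rotated_pairing :: "bool \<Rightarrow> tangle" where
  "rotated_pairing s \<equiv> glue (trace_tangle 2 (\<not> s)) 1 (rotated_mult s) id trace_regions []"

lemma pairing:
  "check_glue [] [] [] id trace_regions (trace_tangle 2 s) 1 (shift 2 (mult_tangle 2 s))"
  by (induct s; code_simp)

lemma half_rotated_mult:
  "check_glue [] [] [] id (rename [((0, 3), (0, 1)), ((0, 1), (1, 3))])
     (mult_tangle 2 (\<not> s)) 1 (shift 2 (reflect (rotation_tangle 2 s)))"
  by (induct s; code_simp)

lemma rotated_mult:
  "check_glue [] [] [] id (rename [((0, 1), (1, 3))])
     (half_rotated_mult s) 2 (shift 3 (rotation_tangle 2 s))"
  by (induct s; code_simp)

lemma rotated_pairing:
  "check_glue [] [] [] id trace_regions (trace_tangle 2 (\<not> s)) 1 (rotated_mult s)"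
  by (induct s; code_simp)

lemma moved_pairing:
  "check_isotopic id (rename [((1, 0), (2, 3)), ((1, 1), (1, 0)), ((1, 2), (1, 1)), ((2, 3), (1, 2))])
     [] (moved_pairing s) [] (rotated_pairing s)"
  by (induct s; code_simp)

section \<open>Finite-dimensional *-algebras with a faithful positive functional\<close>

text \<open>
  The operator theory below refers to tangles only through these axioms; \<open>box_algebra_2\<close>
  further down verifies them for \<open>P\<^bsub>2,s\<^esub>\<close>.
\<close>

locale box_algebra = vector_space "scl A" for A :: "('a::ab_group_add) planar" +
  fixes n :: nat and s :: bool
  assumes subspace_box: "subspace (spc A n s)"
    and finite_box: "\<exists>B. finite B \<and> span B = spc A n s"
    and unit_box: "unit A n s \<in> spc A n s"
    and mul_box: "\<And>x y. x \<in> spc A n s \<Longrightarrow> y \<in> spc A n s \<Longrightarrow> mul A n s x y \<in> spc A n s"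
    and star_box: "\<And>x. x \<in> spc A n s \<Longrightarrow> star A n s x \<in> spc A n s"
    and mul_linear_left: "\<And>a b x y z. x \<in> spc A n s \<Longrightarrow> y \<in> spc A n s \<Longrightarrow> z \<in> spc A n s \<Longrightarrow>
        mul A n s (scl A a x + scl A b y) z = scl A a (mul A n s x z) + scl A b (mul A n s y z)"
    and mul_linear_right: "\<And>a b x y z. x \<in> spc A n s \<Longrightarrow> y \<in> spc A n s \<Longrightarrow> z \<in> spc A n s \<Longrightarrow>
        mul A n s z (scl A a x + scl A b y) = scl A a (mul A n s z x) + scl A b (mul A n s z y)"
    and assoc: "\<And>x y z. x \<in> spc A n s \<Longrightarrow> y \<in> spc A n s \<Longrightarrow> z \<in> spc A n s \<Longrightarrow>
        mul A n s (mul A n s x y) z = mul A n s x (mul A n s y z)"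
    and unit_left: "\<And>x. x \<in> spc A n s \<Longrightarrow> mul A n s (unit A n s) x = x"
    and unit_right: "\<And>x. x \<in> spc A n s \<Longrightarrow> mul A n s x (unit A n s) = x"
    and star_star: "\<And>x. x \<in> spc A n s \<Longrightarrow> star A n s (star A n s x) = x"
    and star_linear: "\<And>a b x y. x \<in> spc A n s \<Longrightarrow> y \<in> spc A n s \<Longrightarrow>
        star A n s (scl A a x + scl A b y) = scl A (cnj a) (star A n s x) + scl A (cnj b) (star A n s y)"
    and star_mul: "\<And>x y. x \<in> spc A n s \<Longrightarrow> y \<in> spc A n s \<Longrightarrow>
        star A n s (mul A n s x y) = mul A n s (star A n s y) (star A n s x)"
    and tr_linear: "\<And>a b x y. x \<in> spc A n s \<Longrightarrow> y \<in> spc A n s \<Longrightarrow>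
        tr A n s (scl A a x + scl A b y) = a * tr A n s x + b * tr A n s y"
    and tr_positive: "\<And>x. x \<in> spc A n s \<Longrightarrow> x \<noteq> 0 \<Longrightarrow>
        Im (tr A n s (mul A n s (star A n s x) x)) = 0 \<and> Re (tr A n s (mul A n s (star A n s x) x)) > 0"
begin

abbreviation M where "M \<equiv> spc A n s"
abbreviation times (infixl "\<cdot>" 70) where "x \<cdot> y \<equiv> mul A n s x y"
abbreviation one ("\<one>") where "\<one> \<equiv> unit A n s"
abbreviation adjoint ("_\<^sup>\<star>" [200] 200) where "x\<^sup>\<star> \<equiv> star A n s x"
abbreviation smul (infixr "*\<^sub>C" 75) where "c *\<^sub>C x \<equiv> scl A c x"
abbreviation trace ("\<tau>") where "\<tau> \<equiv> tr A n s"

lemmas box_closed [simp, intro] = unit_box mul_box star_box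
  subspace_0[OF subspace_box] subspace_add[OF subspace_box] subspace_diff[OF subspace_box]
  subspace_scale[OF subspace_box] subspace_sum[OF subspace_box]

lemmas [simp] = unit_left unit_right star_star

lemma mul_add_left: "x \<in> M \<Longrightarrow> y \<in> M \<Longrightarrow> z \<in> M \<Longrightarrow> (x + y) \<cdot> z = x \<cdot> z + y \<cdot> z"
  using mul_linear_left[of x y z 1 1] by simp

lemma mul_add_right: "x \<in> M \<Longrightarrow> y \<in> M \<Longrightarrow> z \<in> M \<Longrightarrow> z \<cdot> (x + y) = z \<cdot> x + z \<cdot> y"
  using mul_linear_right[of x y z 1 1] by simp

lemma mul_scale_left [simp]: "x \<in> M \<Longrightarrow> z \<in> M \<Longrightarrow> (c *\<^sub>C x) \<cdot> z = c *\<^sub>C (x \<cdot> z)"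
  using mul_linear_left[of x x z c 0] by simp

lemma mul_scale_right [simp]: "x \<in> M \<Longrightarrow> z \<in> M \<Longrightarrow> z \<cdot> (c *\<^sub>C x) = c *\<^sub>C (z \<cdot> x)"
  using mul_linear_right[of x x z c 0] by simp

lemma mul_zero_left [simp]: "z \<in> M \<Longrightarrow> 0 \<cdot> z = 0"
  using mul_scale_left[of z z 0] by simp

lemma mul_zero_right [simp]: "z \<in> M \<Longrightarrow> z \<cdot> 0 = 0"
  using mul_scale_right[of z z 0] by simp

lemma mul_sum_left: "(\<And>i. i \<in> I \<Longrightarrow> f i \<in> M) \<Longrightarrow> z \<in> M \<Longrightarrow> (\<Sum>i\<in>I. f i) \<cdot> z = (\<Sum>i\<in>I. f i \<cdot> z)"
  by (induction I rule: infinite_finite_induct) (auto simp: mul_add_left)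

lemma mul_sum_right: "(\<And>i. i \<in> I \<Longrightarrow> f i \<in> M) \<Longrightarrow> z \<in> M \<Longrightarrow> z \<cdot> (\<Sum>i\<in>I. f i) = (\<Sum>i\<in>I. z \<cdot> f i)"
  by (induction I rule: infinite_finite_induct) (auto simp: mul_add_right)

lemma star_add: "x \<in> M \<Longrightarrow> y \<in> M \<Longrightarrow> (x + y)\<^sup>\<star> = x\<^sup>\<star> + y\<^sup>\<star>"
  using star_linear[of x y 1 1] by simp

lemma star_scale [simp]: "x \<in> M \<Longrightarrow> (c *\<^sub>C x)\<^sup>\<star> = cnj c *\<^sub>C x\<^sup>\<star>"
  using star_linear[of x x c 0] by simp

lemma star_zero [simp]: "0\<^sup>\<star> = 0"
  using star_scale[of 0 0] by simp

lemma star_one [simp]: "\<one>\<^sup>\<star> = \<one>"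
  by (metis star_box star_mul star_star unit_box unit_left unit_right)

lemma tr_add: "x \<in> M \<Longrightarrow> y \<in> M \<Longrightarrow> \<tau> (x + y) = \<tau> x + \<tau> y"
  using tr_linear[of x y 1 1] by simp

lemma tr_scale [simp]: "x \<in> M \<Longrightarrow> \<tau> (c *\<^sub>C x) = c * \<tau> x"
  using tr_linear[of x x c 0] by simp

lemma tr_zero [simp]: "\<tau> 0 = 0"
  using tr_scale[of 0 0] by simp

lemma tr_sum: "(\<And>i. i \<in> I \<Longrightarrow> f i \<in> M) \<Longrightarrow> \<tau> (\<Sum>i\<in>I. f i) = (\<Sum>i\<in>I. \<tau> (f i))"
  by (induction I rule: infinite_finite_induct) (auto simp: tr_add)

lemma faithful: "x \<in> M \<Longrightarrow> \<tau> (x\<^sup>\<star> \<cdot> x) = 0 \<Longrightarrow> x = 0"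
  using tr_positive[of x] by auto

lemma tr_star_mul_nonneg: "x \<in> M \<Longrightarrow> Re (\<tau> (x\<^sup>\<star> \<cdot> x)) \<ge> 0"
  using tr_positive[of x] by (cases "x = 0") auto

subsection \<open>Evaluation of polynomials\<close>

text \<open>
  Horner's scheme, so that multiplicativity follows by induction on the polynomial.
\<close>

definition eval_poly :: "'a \<Rightarrow> complex poly \<Rightarrow> 'a" where
  "eval_poly a p = fold_coeffs (\<lambda>c v. c *\<^sub>C \<one> + a \<cdot> v) p 0"

lemma eval_poly_0 [simp]: "eval_poly a 0 = 0"
  by (simp add: eval_poly_def)

lemma eval_poly_pCons [simp]: "a \<in> M \<Longrightarrow> eval_poly a (pCons c p) = c *\<^sub>C \<one> + a \<cdot> eval_poly a p"
  by (cases "p = 0 \<and> c = 0") (auto simp: eval_poly_def)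

lemma eval_poly_closed [simp, intro]: "a \<in> M \<Longrightarrow> eval_poly a p \<in> M"
  by (induction p) auto

lemma eval_poly_add: "a \<in> M \<Longrightarrow> eval_poly a (p + q) = eval_poly a p + eval_poly a q"
  by (induction p q rule: poly_induct2) (auto simp: scale_left_distrib mul_add_right algebra_simps)

lemma eval_poly_smult: "a \<in> M \<Longrightarrow> eval_poly a (smult c p) = c *\<^sub>C eval_poly a p"
  by (induction p) (auto simp: scale_right_distrib)

lemma eval_poly_diff: "a \<in> M \<Longrightarrow> eval_poly a (p - q) = eval_poly a p - eval_poly a q"
  using eval_poly_add[of a "p - q" q] by (simp add: algebra_simps)

lemma eval_poly_mult: "a \<in> M \<Longrightarrow> eval_poly a (p * q) = eval_poly a p \<cdot> eval_poly a q"
  by (induction p) (auto simp: eval_poly_add eval_poly_smult mul_add_left assoc)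

lemma eval_poly_sum: "a \<in> M \<Longrightarrow> eval_poly a (\<Sum>i\<in>I. f i) = (\<Sum>i\<in>I. eval_poly a (f i))"
  by (induction I rule: infinite_finite_induct) (auto simp: eval_poly_add)

lemma eval_poly_commute: "a \<in> M \<Longrightarrow> eval_poly a p \<cdot> a = a \<cdot> eval_poly a p"
  using eval_poly_mult[of a p "[:0, 1:]"] eval_poly_mult[of a "[:0, 1:]" p] by (simp add: mult.commute)

lemma star_eval_poly: "a \<in> M \<Longrightarrow> a\<^sup>\<star> = a \<Longrightarrow> (eval_poly a p)\<^sup>\<star> = eval_poly a (map_poly cnj p)"
  by (induction p) (auto simp: star_add star_mul eval_poly_commute map_poly_pCons)

text \<open>
  There are more powers of \<open>a\<close> than dimensions.
\<close>

lemma annihilating_poly_exists: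
  assumes "a \<in> M"
  shows "\<exists>p. p \<noteq> 0 \<and> eval_poly a p = 0"
proof -
  obtain B where B: "finite B" "span B = M" using finite_box by auto
  let ?N = "card B"
  let ?pw = "\<lambda>i. eval_poly a (monom 1 i)"
  show ?thesis
  proof (cases "inj_on ?pw {..?N}")
    case True
    have "\<not> independent (?pw ` {..?N})"
    proof
      assume "independent (?pw ` {..?N})"
      then have "card (?pw ` {..?N}) \<le> ?N"
        using independent_span_bound[OF B(1)] B(2) assms by (auto simp: image_subset_iff)
      then show False using card_image[OF True] by simp
    qed
    then obtain u where u: "\<exists>v\<in>?pw ` {..?N}. u v \<noteq> 0" "(\<Sum>v\<in>?pw ` {..?N}. u v *\<^sub>C v) = 0"
      using dependent_finite[of "?pw ` {..?N}"] by auto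
    let ?p = "\<Sum>i\<le>?N. monom (u (?pw i)) i"
    from u(1) obtain i where i: "i \<le> ?N" "u (?pw i) \<noteq> 0" by auto
    have "coeff ?p i = u (?pw i)" using i(1) by (simp add: coeff_sum)
    then have "?p \<noteq> 0" using i by auto
    moreover have "monom (u (?pw i)) i = smult (u (?pw i)) (monom 1 i)" for i
      by (simp add: smult_monom)
    then have "eval_poly a ?p = (\<Sum>i\<le>?N. u (?pw i) *\<^sub>C ?pw i)"
      using assms by (simp add: eval_poly_sum eval_poly_smult)
    then have "eval_poly a ?p = 0" using u(2) True by (simp add: sum.reindex)
    ultimately show ?thesis by blast
  next
    case False
    then obtain i j where ij: "i \<noteq> j" "?pw i = ?pw j" by (auto simp: inj_on_def)
    then have "coeff (monom 1 i - monom 1 j :: complex poly) i = 1" by simp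
    then have "monom 1 i - monom 1 j \<noteq> (0 :: complex poly)" by (metis coeff_0 zero_neq_one)
    then show ?thesis using ij assms by (intro exI[of _ "monom 1 i - monom 1 j"]) (simp add: eval_poly_diff)
  qed
qed

lemma minimal_poly_exists:
  assumes "a \<in> M"
  obtains p where "p \<noteq> 0" "eval_poly a p = 0" "\<And>q. q \<noteq> 0 \<Longrightarrow> eval_poly a q = 0 \<Longrightarrow> degree p \<le> degree q"
  using ex_has_least_nat[of "\<lambda>p. p \<noteq> 0 \<and> eval_poly a p = 0" _ degree] annihilating_poly_exists[OF assms]
  by metis

text \<open>
  The minimal polynomial of \<open>u\<close> has a nonzero constant term, for otherwise the left inverse
  would allow to divide it by the variable. Hence \<open>u\<close> has a right inverse that is a polynomial in \<open>u\<close>.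
\<close>

lemma left_inverse_imp_right_inverse:
  assumes "u \<in> M" "w \<in> M" "w \<cdot> u = \<one>"
  shows "u \<cdot> w = \<one>"
proof -
  obtain p where p: "p \<noteq> 0" "eval_poly u p = 0"
    and min: "\<And>q. q \<noteq> 0 \<Longrightarrow> eval_poly u q = 0 \<Longrightarrow> degree p \<le> degree q"
    using minimal_poly_exists[OF assms(1)] by metis
  obtain c q where pq: "p = pCons c q" by (cases p)
  let ?v = "eval_poly u q"
  have v: "?v \<in> M" using assms by simp
  have eq: "c *\<^sub>C \<one> + u \<cdot> ?v = 0" using p(2) assms pq by simp
  have wu: "w \<cdot> (u \<cdot> ?v) = ?v" using assms v by (simp flip: assoc)
  have "c \<noteq> 0"
  proof
    assume "c = 0"
    then have "?v = 0" using eq wu assms by simp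
    moreover have "q \<noteq> 0" using \<open>c = 0\<close> p pq by auto
    ultimately show False using min[of q] pq by simp
  qed
  have "u \<cdot> ?v = - (c *\<^sub>C \<one>)" using eq by (simp add: eq_neg_iff_add_eq_0 add.commute)
  define k where "k = - 1 / c"
  have k: "k * c = - 1" using \<open>c \<noteq> 0\<close> by (simp add: k_def)
  have "u \<cdot> (k *\<^sub>C ?v) = k *\<^sub>C (u \<cdot> ?v)" using assms v by simp
  also have "\<dots> = - ((k * c) *\<^sub>C \<one>)"
    unfolding \<open>u \<cdot> ?v = - (c *\<^sub>C \<one>)\<close> by simp
  finally have uv: "u \<cdot> (k *\<^sub>C ?v) = \<one>" using k by simp
  have "w = w \<cdot> (u \<cdot> (k *\<^sub>C ?v))" using uv assms by simp
  also have "\<dots> = k *\<^sub>C ?v" using assms v by (simp flip: assoc)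
  finally show ?thesis using uv by simp
qed

lemma eigenvalue_real:
  assumes "a \<in> M" "a\<^sup>\<star> = a" "v \<in> M" "v \<noteq> 0" "a \<cdot> v = z *\<^sub>C v"
  shows "z \<in> \<real>"
proof -
  have "(a \<cdot> v)\<^sup>\<star> \<cdot> v = v\<^sup>\<star> \<cdot> (a \<cdot> v)" using assms(1-3) by (simp add: star_mul assoc)
  then have "\<tau> ((z *\<^sub>C v)\<^sup>\<star> \<cdot> v) = \<tau> (v\<^sup>\<star> \<cdot> (z *\<^sub>C v))" using assms(5) by simp
  then have "cnj z * \<tau> (v\<^sup>\<star> \<cdot> v) = z * \<tau> (v\<^sup>\<star> \<cdot> v)" using assms(3) by simp
  then show ?thesis using faithful assms by (auto simp: Reals_cnj_iff)
qed

text \<open>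
  A self-adjoint nilpotent element vanishes, because \<open>h\<^sup>\<star>h = 0\<close> forces \<open>h = 0\<close>. Applied to \<open>h\<^sup>\<star>h\<close> for
  \<open>h = f(a)\<close>, which commutes with its adjoint, this covers polynomials with complex coefficients.
\<close>

lemma nilpotent_eval_poly:
  assumes "a \<in> M" "a\<^sup>\<star> = a" "eval_poly a (f ^ k) = 0"
  shows "eval_poly a f = 0"
proof -
  have selfadj: "eval_poly a g = 0" if g: "eval_poly a (g ^ m) = 0" "map_poly cnj g = g" for g m
    using g(1)
  proof (induction m rule: less_induct)
    case (less m)
    show ?case
    proof (cases "m \<le> 1")
      case True
      then have "m = 0 \<or> m = 1" by auto
      then show ?thesis
      proof
        assume "m = 0"
        then have "\<one> = 0" using less.prems assms(1) by (simp add: one_pCons)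
        then show ?thesis using assms(1) by (metis eval_poly_closed mul_zero_left unit_left)
      qed (use less.prems in simp)
    next
      case False
      \<comment> \<open>As \<open>2 * (m - 1) \<ge> m\<close>, the self-adjoint element \<open>g(a) ^ (m - 1)\<close> has square zero.\<close>
      let ?k = "m - 1"
      have "g ^ ?k * g ^ ?k = g ^ m * g ^ (m - 2)"
        using False by (simp add: numeral_2_eq_2 flip: power_add)
      then have "eval_poly a (g ^ ?k) \<cdot> eval_poly a (g ^ ?k) = 0"
        using less.prems assms(1) by (metis eval_poly_closed eval_poly_mult mul_zero_left)
      moreover have "(eval_poly a (g ^ ?k))\<^sup>\<star> = eval_poly a (g ^ ?k)"
      proof -
        have "map_poly cnj (g ^ j) = g ^ j" for j
          using g(2) by (intro poly_ext) (metis poly_map_poly_cnj poly_power complex_cnj_power)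
        then show ?thesis using assms by (simp add: star_eval_poly)
      qed
      ultimately have "eval_poly a (g ^ ?k) = 0"
        using faithful[of "eval_poly a (g ^ ?k)"] assms(1) by simp
      then show ?thesis using less.IH[of ?k] False by simp
    qed
  qed
  let ?g = "map_poly cnj f * f"
  have "map_poly cnj ?g = ?g"
    by (intro poly_ext) simp
  moreover have "eval_poly a (?g ^ k) = 0"
    using assms by (simp add: power_mult_distrib eval_poly_mult)
  ultimately have "eval_poly a ?g = 0" using selfadj by blast
  then have "(eval_poly a f)\<^sup>\<star> \<cdot> eval_poly a f = 0"
    using assms by (simp add: eval_poly_mult star_eval_poly)
  then show ?thesis using faithful[of "eval_poly a f"] assms(1) by simp
qed

text \<open>
  The value \<open>f(a)\<close> only depends on \<open>f\<close> on the roots of an annihilating polynomial: by the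
  Nullstellensatz some power of \<open>f\<close> is a multiple of that polynomial, so \<open>f(a)\<close> is nilpotent.
\<close>

lemma eval_poly_eq_0:
  assumes "a \<in> M" "a\<^sup>\<star> = a" "p \<noteq> 0" "eval_poly a p = 0" "\<And>z. poly p z = 0 \<Longrightarrow> poly f z = 0"
  shows "eval_poly a f = 0"
proof -
  have "p dvd f ^ degree p"
    using nullstellensatz_univariate[of p f] assms(3,5) by blast
  then obtain r where "f ^ degree p = p * r" by (rule dvdE)
  then have "eval_poly a (f ^ degree p) = 0" using assms by (simp add: eval_poly_mult)
  then show ?thesis using nilpotent_eval_poly assms by blast
qed

lemma eval_poly_eqI:
  assumes "a \<in> M" "a\<^sup>\<star> = a" "p \<noteq> 0" "eval_poly a p = 0" "\<And>z. poly p z = 0 \<Longrightarrow> poly f z = poly g z"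
  shows "eval_poly a f = eval_poly a g"
  using eval_poly_eq_0[of a p "f - g"] assms by (simp add: eval_poly_diff)

end

lemma lagrange_poly:
  fixes S :: "'b :: field set"
  assumes "finite S" "l \<in> S"
  shows "\<exists>L. \<forall>m\<in>S. poly L m = (if m = l then 1 else 0)"
proof -
  let ?Q = "\<Prod>m\<in>S - {l}. [:- m, 1:]"
  have "poly ?Q l \<noteq> 0" "\<And>m. m \<in> S \<Longrightarrow> m \<noteq> l \<Longrightarrow> poly ?Q m = 0"
    using assms by (auto simp: poly_prod)
  then show ?thesis by (intro exI[of _ "smult (inverse (poly ?Q l)) ?Q"]) auto
qed

context box_algebra begin

text \<open>
  The spectral projections are the values at \<open>a\<close> of the Lagrange polynomials on the roots of the
  minimal polynomial. These roots are eigenvalues of left multiplication by \<open>a\<close> and hence real.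
\<close>

theorem spectral_decomposition_exists:
  assumes "a \<in> M" "a\<^sup>\<star> = a"
  shows "\<exists>S e. spectral_decomposition A n s a S e"
proof -
  obtain p where p: "p \<noteq> 0" "eval_poly a p = 0"
    and min: "\<And>q. q \<noteq> 0 \<Longrightarrow> eval_poly a q = 0 \<Longrightarrow> degree p \<le> degree q"
    using minimal_poly_exists[OF assms(1)] by metis
  have real: "z \<in> \<real>" if root: "poly p z = 0" for z
  proof -
    obtain q where q: "p = [:- z, 1:] * q" using root poly_eq_0_iff_dvd[of p z] unfolding dvd_def by blast
    then have "q \<noteq> 0" using p by auto
    then have "degree p = degree [:- z, 1:] + degree q"
      unfolding q by (intro degree_mult_eq) auto
    then have "degree p = Suc (degree q)" by simp
    then have "eval_poly a q \<noteq> 0" using min[of q] \<open>q \<noteq> 0\<close> by auto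
    moreover have "eval_poly a p = a \<cdot> eval_poly a q - z *\<^sub>C eval_poly a q"
      unfolding q using assms(1)
      by (simp add: eval_poly_diff eval_poly_smult)
    then have "a \<cdot> eval_poly a q = z *\<^sub>C eval_poly a q" using p by simp
    ultimately show ?thesis using eigenvalue_real assms by blast
  qed
  define S where "S = {l :: real. poly p (of_real l) = 0}"
  have roots: "(poly p z = 0) \<longleftrightarrow> (\<exists>l\<in>S. z = of_real l)" for z
    using real by (auto simp: S_def elim!: Reals_cases)
  have "finite (of_real ` S :: complex set)"
    using poly_roots_finite[OF p(1)] by (rule finite_subset[rotated]) (auto simp: S_def)
  then have "finite S" by (rule finite_imageD) (auto simp: inj_on_def)
  have "\<exists>L. \<forall>m\<in>S. poly L (of_real m) = (if m = l then 1 else 0 :: complex)" if "l \<in> S" for l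
    using lagrange_poly[of "of_real ` S :: complex set" "of_real l"] \<open>finite S\<close> that by simp
  then obtain L where L: "\<And>l m. l \<in> S \<Longrightarrow> m \<in> S \<Longrightarrow> poly (L l) (of_real m) = (if m = l then 1 else 0 :: complex)"
    by metis
  have delta: "(\<Sum>k\<in>S. f k * poly (L k) (of_real l)) = f l" if "l \<in> S" for f l
  proof -
    have "(\<Sum>k\<in>S. f k * poly (L k) (of_real l)) = (\<Sum>k\<in>S. if k = l then f k else 0)"
      using L that by (intro sum.cong refl) auto
    then show ?thesis using that \<open>finite S\<close> by simp
  qed
  note eqI = eval_poly_eqI[OF assms p]
  have "eval_poly a (map_poly cnj (L l)) = eval_poly a (L l)" if "l \<in> S" for l
    using L that by (intro eqI) (auto simp: roots)
  moreover have "eval_poly a (L l * L m) = eval_poly a (if l = m then L l else 0)" if "l \<in> S" "m \<in> S" for l m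
    using L that by (intro eqI) (auto simp: roots)
  moreover have "eval_poly a (\<Sum>l\<in>S. L l) = eval_poly a 1"
    using delta[of _ "\<lambda>_. 1"] by (intro eqI) (auto simp: roots poly_sum)
  moreover have "eval_poly a (\<Sum>l\<in>S. smult (of_real l) (L l)) = eval_poly a [:0, 1:]"
    using delta[of _ of_real] by (intro eqI) (auto simp: roots poly_sum)
  ultimately have "spectral_decomposition A n s a S (\<lambda>l. eval_poly a (L l))"
    unfolding spectral_decomposition_def using assms \<open>finite S\<close>
    by (auto simp: star_eval_poly eval_poly_mult eval_poly_sum eval_poly_smult one_pCons)
  then show ?thesis by blast
qed

lemma spectral_decompositionD:
  assumes "spectral_decomposition A n s a S e"
  shows "finite S" "\<And>l. l \<in> S \<Longrightarrow> e l \<in> M" "\<And>l. l \<in> S \<Longrightarrow> (e l)\<^sup>\<star> = e l"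
    "\<And>l m. l \<in> S \<Longrightarrow> m \<in> S \<Longrightarrow> e l \<cdot> e m = (if l = m then e l else 0)"
    "(\<Sum>l\<in>S. e l) = \<one>" "(\<Sum>l\<in>S. of_real l *\<^sub>C e l) = a" "a \<in> M"
  using assms unfolding spectral_decomposition_def by (auto simp del: box_closed intro!: subspace_sum[OF subspace_box] subspace_scale[OF subspace_box])

lemma spectral_decomposition_eigen:
  assumes "spectral_decomposition A n s a S e" "l \<in> S"
  shows "a \<cdot> e l = of_real l *\<^sub>C e l" "e l \<cdot> a = of_real l *\<^sub>C e l"
proof -
  note d = spectral_decompositionD[OF assms(1)]
  have "(\<Sum>m\<in>S. of_real m *\<^sub>C e m) \<cdot> e l = (\<Sum>m\<in>S. (of_real m *\<^sub>C e m) \<cdot> e l)"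
    using d assms(2) by (intro mul_sum_left) auto
  also have "\<dots> = (\<Sum>m\<in>S. if m = l then of_real l *\<^sub>C e l else 0)"
    by (intro sum.cong refl) (use d assms(2) in auto)
  finally show "a \<cdot> e l = of_real l *\<^sub>C e l" using d assms(2) by simp
  have "e l \<cdot> (\<Sum>m\<in>S. of_real m *\<^sub>C e m) = (\<Sum>m\<in>S. e l \<cdot> (of_real m *\<^sub>C e m))"
    using d assms(2) by (intro mul_sum_right) auto
  also have "\<dots> = (\<Sum>m\<in>S. if m = l then of_real l *\<^sub>C e l else 0)"
    by (intro sum.cong refl) (use d assms(2) in auto)
  finally show "e l \<cdot> a = of_real l *\<^sub>C e l" using d assms(2) by simp
qed

text \<open>
  For two decompositions, \<open>l (e l \<cdot> e' m) = e l \<cdot> a \<cdot> e' m = m (e l \<cdot> e' m)\<close>, so only the products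
  with \<open>l = m\<close> survive when one sum is multiplied by the other decomposition of the unit.
\<close>

lemma spectral_sum_unique:
  assumes "spectral_decomposition A n s a S e" "spectral_decomposition A n s a S' e'"
  shows "(\<Sum>l\<in>S. of_real (f l) *\<^sub>C e l) = (\<Sum>l\<in>S'. of_real (f l) *\<^sub>C e' l)"
proof -
  note d = spectral_decompositionD[OF assms(1)] and d' = spectral_decompositionD[OF assms(2)]
  have orth: "of_real (f l) *\<^sub>C (e l \<cdot> e' m) = of_real (f m) *\<^sub>C (e l \<cdot> e' m)" if "l \<in> S" "m \<in> S'" for l m
  proof (cases "l = m")
    case False
    have "of_real l *\<^sub>C (e l \<cdot> e' m) = (e l \<cdot> a) \<cdot> e' m"
      using that d d' by (simp add: spectral_decomposition_eigen[OF assms(1)])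
    also have "\<dots> = of_real m *\<^sub>C (e l \<cdot> e' m)"
      using that d d' by (simp add: assoc spectral_decomposition_eigen[OF assms(2)])
    finally have "e l \<cdot> e' m = 0" using False by simp
    then show ?thesis by simp
  qed simp
  have "(\<Sum>l\<in>S. of_real (f l) *\<^sub>C e l) = (\<Sum>l\<in>S. of_real (f l) *\<^sub>C (e l \<cdot> (\<Sum>m\<in>S'. e' m)))"
    using d d' by simp
  also have "\<dots> = (\<Sum>l\<in>S. \<Sum>m\<in>S'. of_real (f l) *\<^sub>C (e l \<cdot> e' m))"
    by (intro sum.cong refl, subst mul_sum_right) (use d d' in \<open>auto simp: scale_sum_right\<close>)
  also have "\<dots> = (\<Sum>m\<in>S'. \<Sum>l\<in>S. of_real (f m) *\<^sub>C (e l \<cdot> e' m))"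
    using orth by (subst sum.swap) (auto intro!: sum.cong)
  also have "\<dots> = (\<Sum>m\<in>S'. of_real (f m) *\<^sub>C ((\<Sum>l\<in>S. e l) \<cdot> e' m))"
    by (intro sum.cong refl, subst mul_sum_left) (use d d' in \<open>auto simp: scale_sum_right\<close>)
  also have "\<dots> = (\<Sum>m\<in>S'. of_real (f m) *\<^sub>C e' m)" using d d' by simp
  finally show ?thesis .
qed

lemma fun_calc_eq:
  assumes "spectral_decomposition A n s a S e"
  shows "fun_calc A n s f a = (\<Sum>l\<in>S. of_real (f l) *\<^sub>C e l)"
  unfolding fun_calc_def using assms spectral_sum_unique by (intro the_equality) blast+

end

section \<open>Power means\<close>

text \<open>
  Weighted inequality between arithmetic and geometric mean of \<open>u\<close> and \<open>1\<close>, with its case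
  of equality. With \<open>a = 1 - r + r u\<close> it follows from \<open>ln t \<le> t - 1\<close>, applied to \<open>u / a\<close> and \<open>1 / a\<close>.
\<close>

lemma powr_le_tangent:
  fixes u r :: real
  assumes "0 \<le> u" "0 < r" "r \<le> 1"
  shows "u powr r \<le> 1 - r + r * u"
    and "u powr r = 1 - r + r * u \<Longrightarrow> r < 1 \<Longrightarrow> u = 1"
proof -
  have *: "u powr r \<le> 1 - r + r * u \<and> (u powr r = 1 - r + r * u \<longrightarrow> u = 1)" if "r < 1"
  proof (cases "u = 0")
    case True
    then show ?thesis using that by simp
  next
    case False
    define a where "a = 1 - r + r * u"
    have "u > 0" using False assms by simp
    then have "a > 0" using assms that by (auto simp: a_def intro!: add_pos_pos)
    have 1: "ln (u / a) \<le> u / a - 1" "ln (1 / a) \<le> 1 / a - 1"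
      using \<open>u > 0\<close> \<open>a > 0\<close> by (intro ln_le_minus_one; simp)+
    have 2: "r * (u / a - 1) + (1 - r) * (1 / a - 1) = 0"
      using \<open>a > 0\<close> by (simp add: field_simps) (simp add: a_def algebra_simps)
    have 3: "r * ln (u / a) + (1 - r) * ln (1 / a) = r * ln u - ln a"
      using \<open>u > 0\<close> \<open>a > 0\<close> by (simp add: ln_div algebra_simps)
    have 4: "r * ln (u / a) \<le> r * (u / a - 1)" "(1 - r) * ln (1 / a) \<le> (1 - r) * (1 / a - 1)"
      using 1 assms by (intro mult_left_mono; simp)+
    have "r * ln u \<le> ln a" using 2 3 4 by linarith
    then have le: "u powr r \<le> a"
      using \<open>u > 0\<close> \<open>a > 0\<close> by (metis exp_le_cancel_iff exp_ln less_numeral_extra(3) powr_def)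
    moreover have "u = 1" if "u powr r = a"
    proof -
      have "r * ln u = ln a" using that \<open>u > 0\<close> by (metis ln_powr)
      then have "r * ln (u / a) = r * (u / a - 1)" "(1 - r) * ln (1 / a) = (1 - r) * (1 / a - 1)"
        using 2 3 4 by linarith+
      then have "ln (u / a) = u / a - 1" "ln (1 / a) = 1 / a - 1"
        using assms \<open>r < 1\<close> by auto
      then have "u / a = 1" "1 / a = 1"
        using \<open>u > 0\<close> \<open>a > 0\<close> by (metis divide_pos_pos ln_eq_minus_one zero_less_one)+
      then show "u = 1" by simp
    qed
    ultimately show ?thesis by (simp add: a_def)
  qed
  then show "u powr r = 1 - r + r * u \<Longrightarrow> r < 1 \<Longrightarrow> u = 1" by blast
  show "u powr r \<le> 1 - r + r * u" using * assms by (cases "r < 1") auto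
qed

lemma powr_ge_tangent:
  fixes u r :: real
  assumes "0 \<le> u" "1 \<le> r"
  shows "1 - r + r * u \<le> u powr r"
    and "u powr r = 1 - r + r * u \<Longrightarrow> 1 < r \<Longrightarrow> u = 1"
proof -
  have inv: "(u powr r) powr (1 / r) = u" using assms by (simp add: powr_powr)
  have *: "u \<le> 1 - 1 / r + 1 / r * u powr r"
    using powr_le_tangent(1)[of "u powr r" "1 / r"] assms unfolding inv by simp
  have "r * u \<le> r * (1 - 1 / r + 1 / r * u powr r)"
    using * assms by (intro mult_left_mono) auto
  also have "\<dots> = r - 1 + u powr r" using assms by (simp add: field_simps)
  finally show "1 - r + r * u \<le> u powr r" by simp
  assume "u powr r = 1 - r + r * u" "1 < r"
  moreover have "r * (1 - 1 / r + 1 / r * u powr r) = r - 1 + u powr r"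
    using \<open>1 < r\<close> by (simp add: field_simps)
  ultimately have "r * u = r * (1 - 1 / r + 1 / r * u powr r)" by simp
  then have "u = 1 - 1 / r + 1 / r * u powr r" using \<open>1 < r\<close> by simp
  then have "u powr r = 1"
    using powr_le_tangent(2)[of "u powr r" "1 / r"] \<open>1 < r\<close> unfolding inv by simp
  then show "u = 1" using inv by simp
qed

text \<open>
  Jensen's inequality for the powers, by comparing \<open>l powr r\<close> with its tangent \<open>h\<close> at the mean \<open>m\<close>.
\<close>

lemma power_mean:
  fixes w :: "real \<Rightarrow> real"
  assumes fin: "finite S" and nonneg: "\<And>l. l \<in> S \<Longrightarrow> 0 \<le> l"
    and pos: "\<And>l. l \<in> S \<Longrightarrow> 0 < w l" and ne: "S \<noteq> {}" and r: "0 < r"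
  defines "W \<equiv> \<Sum>l\<in>S. w l"
  defines "m \<equiv> (\<Sum>l\<in>S. l * w l) / W"
  shows "r \<le> 1 \<Longrightarrow> (\<Sum>l\<in>S. l powr r * w l) \<le> W * m powr r"
    and "1 \<le> r \<Longrightarrow> W * m powr r \<le> (\<Sum>l\<in>S. l powr r * w l)"
    and "(\<Sum>l\<in>S. l powr r * w l) = W * m powr r \<Longrightarrow> r \<noteq> 1 \<Longrightarrow> S = {m}"
proof -
  have "W > 0" unfolding W_def using fin ne pos by (intro sum_pos) auto
  have zero_sum: "g l = 0" if "(\<Sum>l\<in>S. g l) = 0" "\<And>l. l \<in> S \<Longrightarrow> 0 \<le> g l" "l \<in> S" for g :: "real \<Rightarrow> real" and l
    using sum_nonneg_eq_0_iff[OF fin, of g] that by auto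
  have pos': "0 \<le> w l" if "l \<in> S" for l using pos[OF that] by simp
  have "m \<ge> 0" unfolding m_def using nonneg pos' \<open>W > 0\<close>
    by (intro divide_nonneg_pos sum_nonneg mult_nonneg_nonneg)
  \<comment> \<open>The tangent of \<open>l powr r\<close> at \<open>m\<close>, written homogeneously; its weighted sum is \<open>W * m powr r\<close>.\<close>
  define h where "h = (\<lambda>l. m powr r * (1 - r + r * (l / m)))"
  have zero: "S = {0}" if "m = 0"
  proof -
    have "(\<Sum>l\<in>S. l * w l) = 0" using that \<open>W > 0\<close> by (simp add: m_def)
    then have "l * w l = 0" if "l \<in> S" for l
      using zero_sum[of "\<lambda>l. l * w l" l] nonneg pos' that by simp
    then have "\<forall>l\<in>S. l = 0" using pos by fastforce
    then show ?thesis using ne by auto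
  qed
  have sum_h: "(\<Sum>l\<in>S. h l * w l) = W * m powr r" if "m > 0"
  proof -
    have "(\<Sum>l\<in>S. h l * w l) = m powr r * ((1 - r) * W + r / m * (\<Sum>l\<in>S. l * w l))"
      unfolding h_def W_def by (simp add: sum_distrib_left sum_distrib_right algebra_simps sum.distrib sum_subtractf)
    also have "(\<Sum>l\<in>S. l * w l) = m * W" using \<open>W > 0\<close> by (simp add: m_def)
    finally show ?thesis using that by (simp add: algebra_simps)
  qed
  have scaled: "l powr r = m powr r * (l / m) powr r" if "l \<in> S" "m > 0" for l
    using that nonneg by (simp add: powr_mult[symmetric])
  show "(\<Sum>l\<in>S. l powr r * w l) \<le> W * m powr r" if "r \<le> 1"
  proof (cases "m = 0")
    case False
    then have "m > 0" using \<open>m \<ge> 0\<close> by simp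
    have "l powr r \<le> h l" if "l \<in> S" for l
      unfolding h_def scaled[OF that \<open>m > 0\<close>]
      using powr_le_tangent(1)[of "l / m" r] nonneg r \<open>r \<le> 1\<close> that \<open>m > 0\<close> by (intro mult_left_mono) auto
    then have "(\<Sum>l\<in>S. l powr r * w l) \<le> (\<Sum>l\<in>S. h l * w l)"
      using pos' by (intro sum_mono mult_right_mono) auto
    then show ?thesis using sum_h \<open>m > 0\<close> by simp
  qed (use zero in simp)
  show "W * m powr r \<le> (\<Sum>l\<in>S. l powr r * w l)" if "1 \<le> r"
  proof (cases "m = 0")
    case True
    then show ?thesis using zero by simp
  next
    case False
    then have "m > 0" using \<open>m \<ge> 0\<close> by simp
    have "h l \<le> l powr r" if "l \<in> S" for l
      unfolding h_def scaled[OF that \<open>m > 0\<close>]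
      using powr_ge_tangent(1)[of "l / m" r] nonneg r \<open>1 \<le> r\<close> that \<open>m > 0\<close> by (intro mult_left_mono) auto
    then have "(\<Sum>l\<in>S. h l * w l) \<le> (\<Sum>l\<in>S. l powr r * w l)"
      using pos' by (intro sum_mono mult_right_mono) auto
    then show ?thesis using sum_h \<open>m > 0\<close> by simp
  qed
  show "S = {m}" if eq: "(\<Sum>l\<in>S. l powr r * w l) = W * m powr r" and "r \<noteq> 1"
  proof (cases "m = 0")
    case True
    then show ?thesis using zero by simp
  next
    case False
    then have "m > 0" using \<open>m \<ge> 0\<close> by simp
    have diff: "(\<Sum>l\<in>S. (l powr r - h l) * w l) = 0"
      using eq sum_h \<open>m > 0\<close> by (simp add: left_diff_distrib sum_subtractf)
    have "l powr r = h l" if "l \<in> S" for l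
    proof (cases "r < 1")
      case True
      have "l powr r \<le> h l" if "l \<in> S" for l
        unfolding h_def scaled[OF that \<open>m > 0\<close>]
        using powr_le_tangent(1)[of "l / m" r] nonneg r True that \<open>m > 0\<close> by (intro mult_left_mono) auto
      moreover have "(\<Sum>l\<in>S. (h l - l powr r) * w l) = 0"
        using diff by (simp add: left_diff_distrib sum_subtractf)
      ultimately have "(h l - l powr r) * w l = 0"
        using zero_sum[of "\<lambda>l. (h l - l powr r) * w l" l] pos' that by simp
      then show ?thesis using pos[OF that] by simp
    next
      case False
      have "h l \<le> l powr r" if "l \<in> S" for l
        unfolding h_def scaled[OF that \<open>m > 0\<close>]
        using powr_ge_tangent(1)[of "l / m" r] nonneg r False that \<open>m > 0\<close> by (intro mult_left_mono) auto
      then have "(l powr r - h l) * w l = 0"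
        using zero_sum[of "\<lambda>l. (l powr r - h l) * w l" l] pos' diff that by simp
      then show ?thesis using pos[OF that] by simp
    qed
    then have "(l / m) powr r = 1 - r + r * (l / m)" if "l \<in> S" for l
      using that scaled[OF that \<open>m > 0\<close>] \<open>m > 0\<close> by (auto simp: h_def)
    then have "l / m = 1" if "l \<in> S" for l
      using powr_le_tangent(2)[of "l / m" r] powr_ge_tangent(2)[of "l / m" r] nonneg r that \<open>m > 0\<close> \<open>r \<noteq> 1\<close>
      by (cases "r < 1") auto
    then have "l = m" if "l \<in> S" for l
      using that \<open>m > 0\<close> by simp
    then show ?thesis using ne by auto
  qed
qed

context box_algebra begin

section \<open>Norms through the spectrum\<close>

text \<open>
  Removing the vanishing projections guarantees that all weights \<open>\<tau> (e l)\<close> are positive.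
\<close>

lemma positive_spectral_decomposition:
  assumes "x \<in> M"
  obtains S e where "spectral_decomposition A n s (x\<^sup>\<star> \<cdot> x) S e" "\<And>l. l \<in> S \<Longrightarrow> e l \<noteq> 0"
proof -
  have "(x\<^sup>\<star> \<cdot> x)\<^sup>\<star> = x\<^sup>\<star> \<cdot> x" using assms by (simp add: star_mul)
  then obtain S e where se: "spectral_decomposition A n s (x\<^sup>\<star> \<cdot> x) S e"
    using spectral_decomposition_exists assms by blast
  note d = spectral_decompositionD[OF se]
  let ?S = "{l \<in> S. e l \<noteq> 0}"
  have "(\<Sum>l\<in>?S. e l) = (\<Sum>l\<in>S. e l)" "(\<Sum>l\<in>?S. of_real l *\<^sub>C e l) = (\<Sum>l\<in>S. of_real l *\<^sub>C e l)"
    using d(1) by (auto intro!: sum.mono_neutral_left)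
  then have "spectral_decomposition A n s (x\<^sup>\<star> \<cdot> x) ?S e"
    using d unfolding spectral_decomposition_def by auto
  then show ?thesis using that by blast
qed

context
  fixes x S e
  assumes x [simp]: "x \<in> M" and se: "spectral_decomposition A n s (x\<^sup>\<star> \<cdot> x) S e"
    and nonzero: "\<And>l. l \<in> S \<Longrightarrow> e l \<noteq> 0"
begin

lemmas sd = spectral_decompositionD[OF se]

lemma tr_projection:
  assumes "l \<in> S"
  shows "\<tau> (e l) = of_real (Re (\<tau> (e l)))" "Re (\<tau> (e l)) > 0"
proof -
  have "(e l)\<^sup>\<star> \<cdot> e l = e l" using sd assms by simp
  then have "Im (\<tau> (e l)) = 0" "Re (\<tau> (e l)) > 0"
    using tr_positive[of "e l"] sd(2) nonzero assms by auto
  then show "\<tau> (e l) = of_real (Re (\<tau> (e l)))" "Re (\<tau> (e l)) > 0"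
    by (auto simp: complex_eq_iff)
qed

text \<open>
  As \<open>e l\<close> is a projection, \<open>y\<^sup>\<star> \<cdot> e l \<cdot> y = (e l \<cdot> y)\<^sup>\<star> \<cdot> (e l \<cdot> y)\<close>: the square of the length of \<open>x \<cdot> y\<close>
  is a combination of the nonnegative numbers \<open>c l\<close>, with the spectrum of \<open>x\<^sup>\<star> \<cdot> x\<close> as coefficients.
\<close>

lemma spectral_pairing:
  assumes y: "y \<in> M"
  defines "c \<equiv> \<lambda>l. Re (\<tau> ((e l \<cdot> y)\<^sup>\<star> \<cdot> (e l \<cdot> y)))"
  shows "Re (\<tau> ((x \<cdot> y)\<^sup>\<star> \<cdot> (x \<cdot> y))) = (\<Sum>l\<in>S. l * c l)"
    and "Re (\<tau> (y\<^sup>\<star> \<cdot> y)) = (\<Sum>l\<in>S. c l)"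
proof -
  have c: "y\<^sup>\<star> \<cdot> (e l \<cdot> y) = (e l \<cdot> y)\<^sup>\<star> \<cdot> (e l \<cdot> y)" if "l \<in> S" for l
  proof -
    have "(e l \<cdot> y)\<^sup>\<star> \<cdot> (e l \<cdot> y) = y\<^sup>\<star> \<cdot> ((e l \<cdot> e l) \<cdot> y)"
      using that sd(2,3) y by (simp add: star_mul assoc)
    then show ?thesis using sd(4) that by simp
  qed
  have "(x \<cdot> y)\<^sup>\<star> \<cdot> (x \<cdot> y) = y\<^sup>\<star> \<cdot> ((x\<^sup>\<star> \<cdot> x) \<cdot> y)"
    using y by (simp add: star_mul assoc)
  also have "\<dots> = y\<^sup>\<star> \<cdot> ((\<Sum>l\<in>S. of_real l *\<^sub>C e l) \<cdot> y)" using sd by simp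
  also have "\<dots> = (\<Sum>l\<in>S. of_real l *\<^sub>C (y\<^sup>\<star> \<cdot> (e l \<cdot> y)))"
    by (subst mul_sum_left, use sd(2) y in simp, use y in simp, subst mul_sum_right)
      (use sd(2) y in \<open>auto intro!: sum.cong\<close>)
  finally show "Re (\<tau> ((x \<cdot> y)\<^sup>\<star> \<cdot> (x \<cdot> y))) = (\<Sum>l\<in>S. l * c l)"
    using sd(2) y c by (simp add: tr_sum c_def)
  have "y\<^sup>\<star> \<cdot> y = y\<^sup>\<star> \<cdot> ((\<Sum>l\<in>S. e l) \<cdot> y)" using sd y by simp
  also have "\<dots> = (\<Sum>l\<in>S. y\<^sup>\<star> \<cdot> (e l \<cdot> y))"
    by (subst mul_sum_left, use sd(2) y in simp, use y in simp, subst mul_sum_right)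
      (use sd(2) y in \<open>auto intro!: sum.cong\<close>)
  finally show "Re (\<tau> (y\<^sup>\<star> \<cdot> y)) = (\<Sum>l\<in>S. c l)"
    using sd(2) y c by (simp add: tr_sum c_def)
qed

lemma spectrum_nonneg:
  assumes "l \<in> S"
  shows "0 \<le> l"
proof -
  have "(e m \<cdot> e l)\<^sup>\<star> \<cdot> (e m \<cdot> e l) = (if m = l then e l else 0)" if "m \<in> S" for m
    using that assms sd by auto
  then have "(\<Sum>m\<in>S. m * Re (\<tau> ((e m \<cdot> e l)\<^sup>\<star> \<cdot> (e m \<cdot> e l)))) = (\<Sum>m\<in>S. if m = l then l * Re (\<tau> (e l)) else 0)"
    by (intro sum.cong) auto
  then have "l * Re (\<tau> (e l)) = Re (\<tau> ((x \<cdot> e l)\<^sup>\<star> \<cdot> (x \<cdot> e l)))"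
    using spectral_pairing(1)[of "e l"] sd(1,2) assms by simp
  also have "\<dots> \<ge> 0" using tr_star_mul_nonneg sd(2) assms by simp
  finally show ?thesis using tr_projection(2)[OF assms] by (simp add: zero_le_mult_iff)
qed

lemma tr_one_spectral: "Re (\<tau> \<one>) = (\<Sum>l\<in>S. Re (\<tau> (e l)))"
  using tr_sum[of S e] sd by simp

lemma tr_square_spectral: "Re (\<tau> (x\<^sup>\<star> \<cdot> x)) = (\<Sum>l\<in>S. l * Re (\<tau> (e l)))"
  using tr_sum[of S "\<lambda>l. of_real l *\<^sub>C e l"] sd by simp

lemma tr_fun_calc_abs_val:
  "Re (\<tau> (fun_calc A n s f (abs_val A n s x))) = (\<Sum>l\<in>S. f (sqrt l) * Re (\<tau> (e l)))"
proof -
  have inj: "inj_on sqrt S" by (auto simp: inj_on_def)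
  have sq: "(sqrt l)\<^sup>2 = l" if "l \<in> S" for l using spectrum_nonneg[OF that] by simp
  have "abs_val A n s x = (\<Sum>l\<in>S. of_real (sqrt l) *\<^sub>C e l)"
    unfolding abs_val_def by (rule fun_calc_eq[OF se])
  moreover have "spectral_decomposition A n s (\<Sum>l\<in>S. of_real (sqrt l) *\<^sub>C e l) (sqrt ` S) (\<lambda>t. e (t\<^sup>2))"
    using sd inj sq unfolding spectral_decomposition_def by (auto simp: sum.reindex intro!: sum.cong)
  ultimately have "fun_calc A n s f (abs_val A n s x) = (\<Sum>t\<in>sqrt ` S. of_real (f t) *\<^sub>C e (t\<^sup>2))"
    by (simp add: fun_calc_eq)
  also have "\<dots> = (\<Sum>l\<in>S. of_real (f (sqrt l)) *\<^sub>C e l)"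
    using inj sq by (simp add: sum.reindex)
  finally show ?thesis using sd by (simp add: tr_sum)
qed

text \<open>
  The maximum is attained at the normalised spectral projection of the largest eigenvalue.
\<close>

lemma op_norm_spectral:
  assumes "S \<noteq> {}"
  shows "op_norm A n s x = sqrt (Max S)"
  unfolding op_norm_def
proof (rule cSup_eq_maximum)
  let ?l = "Max S"
  have l: "?l \<in> S" using assms sd(1) by simp
  let ?w = "Re (\<tau> (e ?l))"
  have w: "?w > 0" using tr_projection l by simp
  define y where "y = of_real (1 / sqrt ?w) *\<^sub>C e ?l"
  have y: "y \<in> M" using l sd(2) by (simp add: y_def)
  have *: "Re (\<tau> ((e m \<cdot> y)\<^sup>\<star> \<cdot> (e m \<cdot> y))) = (if m = ?l then 1 else 0)" if "m \<in> S" for m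
  proof -
    have "(e m \<cdot> y)\<^sup>\<star> \<cdot> (e m \<cdot> y) = (if m = ?l then of_real (1 / ?w) *\<^sub>C e ?l else 0)"
      using that l sd(2-4) w by (auto simp: y_def simp flip: of_real_mult)
    then show ?thesis using w sd(2) l by auto
  qed
  have "(\<Sum>m\<in>S. f m * Re (\<tau> ((e m \<cdot> y)\<^sup>\<star> \<cdot> (e m \<cdot> y)))) = f ?l" for f
  proof -
    have "(\<Sum>m\<in>S. f m * Re (\<tau> ((e m \<cdot> y)\<^sup>\<star> \<cdot> (e m \<cdot> y)))) = (\<Sum>m\<in>S. if m = ?l then f m else 0)"
      using * by (intro sum.cong refl) auto
    then show ?thesis using sd(1) l by simp
  qed
  from this[of "\<lambda>_. 1"] this[of "\<lambda>m. m"]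
  have "L2_length A n s y = 1" "L2_length A n s (x \<cdot> y) = sqrt ?l"
    unfolding L2_length_def spectral_pairing[OF y] by simp_all
  then show "sqrt ?l \<in> {L2_length A n s (x \<cdot> y) |y. y \<in> M \<and> L2_length A n s y \<le> 1}"
    using y by (auto intro!: exI[of _ y])
next
  fix t assume "t \<in> {L2_length A n s (x \<cdot> y) |y. y \<in> M \<and> L2_length A n s y \<le> 1}"
  then obtain y where y: "y \<in> M" "L2_length A n s y \<le> 1" "t = L2_length A n s (x \<cdot> y)" by auto
  let ?c = "\<lambda>l. Re (\<tau> ((e l \<cdot> y)\<^sup>\<star> \<cdot> (e l \<cdot> y)))"
  have "(\<Sum>l\<in>S. l * ?c l) \<le> (\<Sum>l\<in>S. Max S * ?c l)"
    using sd(1,2) y tr_star_mul_nonneg by (intro sum_mono mult_right_mono) auto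
  also have "\<dots> = Max S * (\<Sum>l\<in>S. ?c l)" by (simp add: sum_distrib_left)
  also have "\<dots> \<le> Max S * 1"
  proof (rule mult_left_mono)
    show "(\<Sum>l\<in>S. ?c l) \<le> 1"
      using y(2) unfolding L2_length_def spectral_pairing(2)[OF y(1)] by simp
    show "0 \<le> Max S" using spectrum_nonneg sd(1) assms by simp
  qed
  finally show "t \<le> sqrt (Max S)"
    unfolding y(3) L2_length_def spectral_pairing(1)[OF y(1)] by simp
qed

lemma p_norm_spectral:
  assumes "n = 2" "0 < r"
  shows "p_norm A s (ennreal r) x = (\<Sum>l\<in>S. l powr (r / 2) * Re (\<tau> (e l))) powr (1 / r)"
proof -
  have "sqrt l powr r = l powr (r / 2)" if "l \<in> S" for l
    using spectrum_nonneg[OF that] by (simp add: powr_half_sqrt[symmetric] powr_powr)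
  then show ?thesis
    using tr_fun_calc_abs_val[of "\<lambda>t. t powr r"] assms by (simp add: p_norm_def)
qed

lemma p_norm_top_spectral:
  assumes "n = 2" "S \<noteq> {}"
  shows "p_norm A s \<infinity> x = sqrt (Max S)"
  using op_norm_spectral assms by (simp add: p_norm_def)

end

end

section \<open>The p-norms and the 2-norm\<close>

lemma recip_simps: "recip \<infinity> = 0" "0 < r \<Longrightarrow> recip (ennreal r) = 1 / r"
proof -
  show "recip \<infinity> = 0" by (simp add: recip_def)
  show "recip (ennreal r) = 1 / r" if "0 < r"
    using that divide_ennreal[of 1 r] by (simp add: recip_def)
qed

lemma exponent_cases:
  assumes "0 < p"
  obtains "p = \<infinity>" "recip p = 0" | r where "0 < r" "p = ennreal r" "recip p = 1 / r"
  using assms recip_simps by (cases p) (auto simp: infinity_ennreal_def)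

context box_algebra begin

lemma L2_length_powr:
  assumes "x \<in> M" "Re (\<tau> \<one>) > 0"
  shows "Re (\<tau> \<one>) powr (k - 1 / 2) * L2_length A n s x =
    Re (\<tau> \<one>) powr k * sqrt (Re (\<tau> (x\<^sup>\<star> \<cdot> x)) / Re (\<tau> \<one>))"
  using assms by (simp add: L2_length_def powr_diff powr_half_sqrt real_sqrt_divide)

text \<open>
  Hoelder's inequality against the 2-norm, on a space of total mass \<open>\<tau> \<one>\<close>. On the spectrum of
  \<open>x\<^sup>\<star> \<cdot> x\<close>, with weights \<open>\<tau> (e l)\<close> and mean \<open>m\<close>, it becomes a comparison of the power mean with exponent \<open>p / 2\<close>
  and the arithmetic mean, or of the maximum and the arithmetic mean. Equality forces
  a one-point spectrum, unless the exponent is 2.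
\<close>

lemma p_norm_compare_L2:
  assumes "n = 2" "x \<in> M" "0 < p" and W: "Re (\<tau> \<one>) > 0"
  shows "recip p \<le> 1 / 2 \<Longrightarrow> Re (\<tau> \<one>) powr (recip p - 1 / 2) * L2_length A n s x \<le> p_norm A s p x"
    and "recip p \<ge> 1 / 2 \<Longrightarrow> p_norm A s p x \<le> Re (\<tau> \<one>) powr (recip p - 1 / 2) * L2_length A n s x"
    and "p_norm A s p x = Re (\<tau> \<one>) powr (recip p - 1 / 2) * L2_length A n s x \<Longrightarrow> recip p \<noteq> 1 / 2 \<Longrightarrow>
      \<exists>m\<ge>0. x\<^sup>\<star> \<cdot> x = of_real m *\<^sub>C \<one>"
proof -
  obtain S e where se: "spectral_decomposition A n s (x\<^sup>\<star> \<cdot> x) S e" and nz: "\<And>l. l \<in> S \<Longrightarrow> e l \<noteq> 0"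
    using positive_spectral_decomposition assms by metis
  note d = spectral_decompositionD[OF se]
  define w where "w = (\<lambda>l. Re (\<tau> (e l)))"
  define V where "V = Re (\<tau> \<one>)"
  define m where "m = Re (\<tau> (x\<^sup>\<star> \<cdot> x)) / V"
  have V: "V = (\<Sum>l\<in>S. w l)" "V > 0"
    using tr_one_spectral[OF assms(2) se nz] W by (simp_all add: V_def w_def)
  have m: "m = (\<Sum>l\<in>S. l * w l) / (\<Sum>l\<in>S. w l)"
    using tr_square_spectral[OF assms(2) se nz] V(1) by (simp add: m_def w_def)
  have "m \<ge> 0" using tr_star_mul_nonneg assms(2) V(2) by (simp add: m_def)
  have "S \<noteq> {}" using V by auto
  have nonneg: "0 \<le> l" "0 < w l" if "l \<in> S" for l
    using spectrum_nonneg[OF assms(2) se nz that] tr_projection(2)[OF assms(2) se nz that] by (auto simp: w_def)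
  note pm = power_mean[of S w, OF d(1) nonneg \<open>S \<noteq> {}\<close>, folded m V(1)]
  have scalar: "\<exists>m\<ge>0. x\<^sup>\<star> \<cdot> x = of_real m *\<^sub>C \<one>" if "S = {l}" for l
    using d(5,6) nonneg that by auto
  have rhs: "Re (\<tau> \<one>) powr (k - 1 / 2) * L2_length A n s x = V powr k * sqrt m" for k
    using L2_length_powr[OF assms(2) W] by (simp add: V_def m_def)
  have "(recip p \<le> 1 / 2 \<longrightarrow> V powr recip p * sqrt m \<le> p_norm A s p x) \<and>
      (recip p \<ge> 1 / 2 \<longrightarrow> p_norm A s p x \<le> V powr recip p * sqrt m) \<and>
      (p_norm A s p x = V powr recip p * sqrt m \<and> recip p \<noteq> 1 / 2 \<longrightarrow> (\<exists>m\<ge>0. x\<^sup>\<star> \<cdot> x = of_real m *\<^sub>C \<one>))"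
    using assms(3)
  proof (cases rule: exponent_cases)
    case 1
    have N: "p_norm A s p x = sqrt (Max S)"
      using p_norm_top_spectral[OF assms(2) se nz assms(1) \<open>S \<noteq> {}\<close>] 1 by simp
    have T: "(\<Sum>l\<in>S. l * w l) = m * V" using V m by simp
    have gap: "(\<Sum>l\<in>S. (Max S - l) * w l) = (Max S - m) * V"
      using T V(1) by (simp add: left_diff_distrib sum_subtractf sum_distrib_left)
    have gap_nonneg: "0 \<le> (Max S - l) * w l" if "l \<in> S" for l
      using d(1) that nonneg(2)[OF that] by simp
    have "0 \<le> (\<Sum>l\<in>S. (Max S - l) * w l)" using gap_nonneg by (intro sum_nonneg)
    then have le: "m \<le> Max S" using gap V(2) by (simp add: zero_le_mult_iff)
    have "S = {m}" if "m = Max S"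
    proof -
      have "(Max S - l) * w l = 0" if "l \<in> S" for l
        using gap \<open>m = Max S\<close> gap_nonneg that sum_nonneg_eq_0_iff[OF d(1), of "\<lambda>l. (Max S - l) * w l"] by simp
      then have "l = m" if "l \<in> S" for l using that nonneg(2) \<open>m = Max S\<close> by fastforce
      then show ?thesis using \<open>S \<noteq> {}\<close> by auto
    qed
    then show ?thesis using N 1 V(2) le scalar \<open>m \<ge> 0\<close> by auto
  next
    case (2 r)
    have N: "p_norm A s p x = (\<Sum>l\<in>S. l powr (r / 2) * w l) powr (1 / r)"
      using p_norm_spectral[OF assms(2) se nz assms(1) \<open>0 < r\<close>] 2 by (simp add: w_def)
    have "0 \<le> (\<Sum>l\<in>S. l powr (r / 2) * w l)"
      using nonneg by (intro sum_nonneg mult_nonneg_nonneg) (auto intro: less_imp_le)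
    have R: "V powr recip p * sqrt m = (V * m powr (r / 2)) powr (1 / r)"
      using V(2) \<open>m \<ge> 0\<close> 2 by (simp add: powr_mult powr_powr powr_half_sqrt)
    have "0 \<le> V * m powr (r / 2)" using V(2) by simp
    show ?thesis
    proof (intro conjI impI)
      assume "recip p \<le> 1 / 2"
      then have "1 \<le> r / 2" using 2(1,3) by (simp add: field_simps)
      then show "V powr recip p * sqrt m \<le> p_norm A s p x"
        unfolding N R using pm(2)[of "r / 2"] \<open>0 < r\<close> \<open>0 \<le> V * m powr (r / 2)\<close> by (intro powr_mono2) auto
    next
      assume "recip p \<ge> 1 / 2"
      then have "r / 2 \<le> 1" using 2(1,3) by (simp add: field_simps)
      then show "p_norm A s p x \<le> V powr recip p * sqrt m"
        unfolding N R using pm(1)[of "r / 2"] \<open>0 < r\<close> \<open>0 \<le> (\<Sum>l\<in>S. l powr (r / 2) * w l)\<close>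
        by (intro powr_mono2) auto
    next
      assume eq: "p_norm A s p x = V powr recip p * sqrt m \<and> recip p \<noteq> 1 / 2"
      then have "(\<Sum>l\<in>S. l powr (r / 2) * w l) powr (1 / r) = (V * m powr (r / 2)) powr (1 / r)"
        by (simp only: N R)
      then have "((\<Sum>l\<in>S. l powr (r / 2) * w l) powr (1 / r)) powr r = ((V * m powr (r / 2)) powr (1 / r)) powr r"
        by (simp only:)
      then have "(\<Sum>l\<in>S. l powr (r / 2) * w l) = V * m powr (r / 2)"
        using \<open>0 < r\<close> \<open>0 \<le> V * m powr (r / 2)\<close> \<open>0 \<le> (\<Sum>l\<in>S. l powr (r / 2) * w l)\<close>
        by (simp add: powr_powr)
      moreover have "r / 2 \<noteq> 1" using eq 2 by auto
      ultimately have "S = {m}" using pm(3)[of "r / 2"] \<open>0 < r\<close> by simp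
      then show "\<exists>m\<ge>0. x\<^sup>\<star> \<cdot> x = of_real m *\<^sub>C \<one>" by (rule scalar)
    qed
  qed
  then show "recip p \<le> 1 / 2 \<Longrightarrow> Re (\<tau> \<one>) powr (recip p - 1 / 2) * L2_length A n s x \<le> p_norm A s p x"
    and "recip p \<ge> 1 / 2 \<Longrightarrow> p_norm A s p x \<le> Re (\<tau> \<one>) powr (recip p - 1 / 2) * L2_length A n s x"
    and "p_norm A s p x = Re (\<tau> \<one>) powr (recip p - 1 / 2) * L2_length A n s x \<Longrightarrow> recip p \<noteq> 1 / 2 \<Longrightarrow>
      \<exists>m\<ge>0. x\<^sup>\<star> \<cdot> x = of_real m *\<^sub>C \<one>"
    unfolding rhs by blast+
qed

lemma p_norm_of_scaled_isometry:
  assumes "n = 2" "x \<in> M" "0 < p" and W: "Re (\<tau> \<one>) > 0" and "m \<ge> 0" "x\<^sup>\<star> \<cdot> x = of_real m *\<^sub>C \<one>"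
  shows "p_norm A s p x = sqrt m * Re (\<tau> \<one>) powr recip p"
proof -
  have "\<one> \<noteq> 0" using W by auto
  have se: "spectral_decomposition A n s (x\<^sup>\<star> \<cdot> x) {m} (\<lambda>_. \<one>)"
    using assms(6) by (simp add: spectral_decomposition_def)
  have nz: "\<And>l. l \<in> {m} \<Longrightarrow> \<one> \<noteq> 0" using \<open>\<one> \<noteq> 0\<close> by simp
  show ?thesis using assms(3)
  proof (cases rule: exponent_cases)
    case 1
    then show ?thesis using p_norm_top_spectral[OF assms(2) se nz assms(1)] W by simp
  next
    case (2 r)
    then show ?thesis using p_norm_spectral[OF assms(2) se nz assms(1), where r = r] W \<open>m \<ge> 0\<close>
      by (simp add: powr_mult powr_powr powr_half_sqrt)
  qed
qed

end

section \<open>Subfactor planar algebras as families of *-algebras\<close>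

text \<open>
  The algebraic laws below share one pattern: the value of a composite picture is computed by
  \<open>act_glue\<close>, and \<open>act_isotopic\<close> replaces the picture by another drawing of it.
\<close>

locale subfactor_pa =
  fixes A :: "('a::ab_group_add) planar"
  assumes spa: "subfactor_planar_algebra A"
begin

lemma pa: "planar_algebra A" and psa: "planar_star_algebra A"
  using spa by (auto simp: subfactor_planar_algebra_def planar_star_algebra_def)

lemma vs: "vector_space (scl A)"
  using pa by (simp add: planar_algebra_def)

sublocale vector_space "scl A" by (rule vs)

lemma subspace_spc: "subspace (spc A n s)"
  using pa unfolding planar_algebra_def by (elim conjE) blast

lemma act_spc: "is_tangle T \<Longrightarrow> x \<in> inputs A T \<Longrightarrow> act A T x \<in> spc A (bpts T 0) (unshaded T 0)"
  using pa unfolding planar_algebra_def by (elim conjE) blast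

lemma act_cong: "is_tangle T \<Longrightarrow> x \<in> inputs A T \<Longrightarrow> (\<And>d. d \<in> discs T \<Longrightarrow> x d = y d) \<Longrightarrow> act A T x = act A T y"
proof -
  assume prems: "is_tangle T" "x \<in> inputs A T" "\<And>d. d \<in> discs T \<Longrightarrow> x d = y d"
  have "\<forall>T x y. is_tangle T \<and> x \<in> inputs A T \<and> (\<forall>d\<in>discs T. x d = y d) \<longrightarrow> act A T x = act A T y"
    using pa unfolding planar_algebra_def by (elim conjE)
  then show ?thesis using prems by blast
qed

lemma act_linear:
  "is_tangle T \<Longrightarrow> x \<in> inputs A T \<Longrightarrow> d \<in> discs T \<Longrightarrow>
   v \<in> spc A (bpts T d) (unshaded T d) \<Longrightarrow> w \<in> spc A (bpts T d) (unshaded T d) \<Longrightarrow>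
   act A T (x(d := scl A a v + scl A b w)) = scl A a (act A T (x(d := v))) + scl A b (act A T (x(d := w)))"
  using pa unfolding planar_algebra_def by blast

lemma act_id: "v \<in> spc A n s \<Longrightarrow> act A (id_tangle n s) (\<lambda>_. v) = v"
  using pa unfolding planar_algebra_def by blast

lemma act_isotopic:
  "check_isotopic \<sigma> \<rho> ls T ls' T' \<Longrightarrow> x \<in> inputs A T' \<Longrightarrow> act A T' x = act A T (x \<circ> \<sigma>)"
  using pa check_isotopic_sound[of \<sigma> \<rho> ls T ls' T'] unfolding planar_algebra_def by blast

lemma act_glue:
  "check_glue lT lS lU f g T i S \<Longrightarrow> x \<in> inputs A (glue T i S f g lU) \<Longrightarrow>
   act A (glue T i S f g lU) x = act A T (x(i := act A S x))"
  using pa check_glue_sound[of lT lS lU f g T i S] unfolding planar_algebra_def by blast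

lemma act_shift:
  assumes "check_tangle ls T" "check_tangle ls' (shift k T)" "x \<in> inputs A (shift k T)"
  shows "act A (shift k T) x = act A T (\<lambda>d. x (if d = 0 then 0 else d + k))"
proof -
  have "act A (shift k T) x = act A T (x \<circ> (\<lambda>d. if d = 0 then 0 else d + k))"
    using pa assms(3) check_tangle_sound[OF assms(1)] check_tangle_sound[OF assms(2)] isotopic_shift[of k T]
    unfolding planar_algebra_def by blast
  then show ?thesis by (simp add: o_def)
qed

lemma check_glueD: "check_glue lT lS lU f g T i S \<Longrightarrow> check_tangle lS S"
  "check_glue lT lS lU f g T i S \<Longrightarrow> check_tangle lU (glue T i S f g lU)"
  unfolding check_glue_def by blast+

lemma star_spc: "v \<in> spc A n s \<Longrightarrow> star A n s v \<in> spc A n s"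
  and star_star: "v \<in> spc A n s \<Longrightarrow> star A n s (star A n s v) = v"
  using psa unfolding planar_star_algebra_def by blast+

lemma star_linear:
  "v \<in> spc A n s \<Longrightarrow> w \<in> spc A n s \<Longrightarrow>
   star A n s (scl A a v + scl A b w) = scl A (cnj a) (star A n s v) + scl A (cnj b) (star A n s w)"
  using psa unfolding planar_star_algebra_def by blast

lemma star_act:
  "is_tangle T \<Longrightarrow> x \<in> inputs A T \<Longrightarrow> star A (bpts T 0) (unshaded T 0) (act A T x) =
     act A (reflect T) (\<lambda>d. star A (bpts T d) (unshaded T d) (x d))"
  using psa unfolding planar_star_algebra_def by blast

lemma act_no_discs: "is_tangle T \<Longrightarrow> discs T = {} \<Longrightarrow> act A T x = act A T y"
  using act_cong[of T x y] by (simp add: inputs_def)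

lemma mul_spc:
  assumes "check_tangle [] (mult_tangle n s)" "x \<in> spc A n s" "y \<in> spc A n s"
  shows "mul A n s x y \<in> spc A n s"
  using act_spc[OF check_tangle_sound[OF assms(1)], of "\<lambda>d. if d = 1 then x else y"] assms(2,3)
  by (simp add: mul_def inputs_def mult_tangle_def)

lemma mul_linear:
  assumes "check_tangle [] (mult_tangle n s)" "x \<in> spc A n s" "y \<in> spc A n s" "z \<in> spc A n s"
  shows "mul A n s (scl A a x + scl A b y) z = scl A a (mul A n s x z) + scl A b (mul A n s y z)"
    and "mul A n s z (scl A a x + scl A b y) = scl A a (mul A n s z x) + scl A b (mul A n s z y)"
proof -
  let ?T = "mult_tangle n s"
  have T: "is_tangle ?T" by (rule check_tangle_sound[OF assms(1)])
  have mul: "mul A n s v w = act A ?T ((\<lambda>_. w)(1 := v))" "mul A n s v w = act A ?T ((\<lambda>_. v)(2 := w))"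
    if "v \<in> spc A n s" "w \<in> spc A n s" for v w
    unfolding mul_def using that by (intro act_cong T; auto simp: inputs_def mult_tangle_def)+
  have 1: "scl A a x + scl A b y \<in> spc A n s"
    using assms subspace_spc by (intro subspace_add subspace_scale)
  show "mul A n s (scl A a x + scl A b y) z = scl A a (mul A n s x z) + scl A b (mul A n s y z)"
    unfolding mul(1)[OF 1 assms(4)] mul(1)[OF assms(2,4)] mul(1)[OF assms(3,4)]
    using assms by (intro act_linear T) (auto simp: inputs_def mult_tangle_def)
  show "mul A n s z (scl A a x + scl A b y) = scl A a (mul A n s z x) + scl A b (mul A n s z y)"
    unfolding mul(2)[OF assms(4) 1] mul(2)[OF assms(4,2)] mul(2)[OF assms(4,3)]
    using assms by (intro act_linear T) (auto simp: inputs_def mult_tangle_def)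
qed

lemma act_mult:
  assumes "check_tangle [] (mult_tangle n s)" "x 1 \<in> spc A n s" "x 2 \<in> spc A n s"
  shows "act A (mult_tangle n s) x = mul A n s (x 1) (x 2)"
  unfolding mul_def using assms(2,3)
  by (intro act_cong check_tangle_sound[OF assms(1)]) (auto simp: inputs_def mult_tangle_def)

lemma unit_spc: 
  assumes "check_tangle [] (unit_tangle n s)" 
  shows "unit A n s \<in> spc A n s"
  using act_spc[OF check_tangle_sound[OF assms], of "\<lambda>_. 0"]
  by (simp add: unit_def inputs_def unit_tangle_def)

lemma act_unit: 
  assumes "check_tangle [] (unit_tangle n s)" 
  shows "act A (unit_tangle n s) x = unit A n s"
  unfolding unit_def by (intro act_no_discs check_tangle_sound[OF assms]) (simp add: unit_tangle_def)

lemma unit_mul_general: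
  assumes "check_tangle [] (mult_tangle n s)" "check_tangle [] (unit_tangle n s)"
    and glue: "check_glue [] [] [] f g (mult_tangle n s) 1 (unit_tangle n s)"
    and iso: "check_isotopic (rename [(1, 2)]) \<rho> [] (id_tangle n s) []
      (glue (mult_tangle n s) 1 (unit_tangle n s) f g [])"
    and v: "v \<in> spc A n s"
  shows "mul A n s (unit A n s) v = v"
proof -
  let ?U = "glue (mult_tangle n s) 1 (unit_tangle n s) f g []"
  have x: "(\<lambda>_. v) \<in> inputs A ?U" using v by (simp add: inputs_def glue_def mult_tangle_def unit_tangle_def)
  have "act A ?U (\<lambda>_. v) = mul A n s (unit A n s) v"
    unfolding act_glue[OF glue x] act_unit[OF assms(2)]
    by (subst act_mult[OF assms(1)]) (use v unit_spc[OF assms(2)] in auto)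
  moreover have "act A ?U (\<lambda>_. v) = v"
    unfolding act_isotopic[OF iso x] using act_id[OF v] by (simp add: o_def)
  ultimately show ?thesis by simp
qed

lemmas unit_mul =
  unit_mul_general[OF check_mult(1) check_unit(1) unit_mult_0]
  unit_mul_general[OF check_mult(2) check_unit(2) unit_mult_1]
  unit_mul_general[OF check_mult(3) check_unit(3) unit_mult_2]

lemma mul_unit:
  assumes v: "v \<in> spc A 2 s"
  shows "mul A 2 s v (unit A 2 s) = v"
proof -
  have x: "(\<lambda>_. v) \<in> inputs A (mult_unit_2 s)"
    using v by (simp add: inputs_def glue_def mult_tangle_def unit_tangle_def)
  have "act A (mult_unit_2 s) (\<lambda>_. v) = mul A 2 s v (unit A 2 s)"
    unfolding act_glue[OF mult_unit_2(1) x] act_unit[OF check_unit(3)]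
    by (subst act_mult[OF check_mult(3)]) (use v unit_spc[OF check_unit(3)] in auto)
  moreover have "act A (mult_unit_2 s) (\<lambda>_. v) = v"
    unfolding act_isotopic[OF mult_unit_2(2) x] using act_id[OF v] by (simp add: o_def)
  ultimately show ?thesis by simp
qed

lemma act_shifted_mult:
  assumes "x 3 \<in> spc A 2 s" "x 4 \<in> spc A 2 s"
  shows "act A (shift 2 (mult_tangle 2 s)) x = mul A 2 s (x 3) (x 4)"
proof -
  have "x \<in> inputs A (shift 2 (mult_tangle 2 s))"
    using assms by (auto simp: inputs_def shift_def mult_tangle_def Let_def simp flip: numeral_3_eq_3)
  then have "act A (shift 2 (mult_tangle 2 s)) x =
      act A (mult_tangle 2 s) (\<lambda>d. x (if d = 0 then 0 else d + 2))"
    by (rule act_shift[OF check_mult(3) check_glueD(1)[OF mult_assoc(1)]])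
  also have "\<dots> = mul A 2 s (x 3) (x 4)"
  proof -
    have "(if (1::nat) = 0 then 0 else 1 + 2) = (3::nat)" "(if (2::nat) = 0 then 0 else 2 + 2) = (4::nat)"
      by simp_all
    then show ?thesis
      by (subst act_mult[OF check_mult(3)]) (simp_all only: assms)
  qed
  finally show ?thesis .
qed

lemma mul_assoc:
  assumes v: "v \<in> spc A 2 s" "w \<in> spc A 2 s" "z \<in> spc A 2 s"
  shows "mul A 2 s (mul A 2 s v w) z = mul A 2 s v (mul A 2 s w z)"
proof -
  let ?y = "\<lambda>d. if d = 1 then v else if d = 3 then w else z"
  let ?x = "\<lambda>d. if d = 3 then v else if d = 4 then w else z"
  have y: "?y \<in> inputs A (mult_mult_right s)"
    using v by (auto simp: inputs_def glue_def mult_tangle_def shift_def Let_def)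
  have x: "?x \<in> inputs A (mult_mult_left s)"
    using v by (auto simp: inputs_def glue_def mult_tangle_def shift_def Let_def)
  note closed = mul_spc[OF check_mult(3)]
  have "act A (mult_mult_right s) ?y = mul A 2 s v (mul A 2 s w z)"
    unfolding act_glue[OF mult_assoc(2) y]
    using v closed by (simp add: act_shifted_mult act_mult[OF check_mult(3)])
  moreover have "act A (mult_mult_left s) ?x = mul A 2 s (mul A 2 s v w) z"
    unfolding act_glue[OF mult_assoc(1) x]
    using v closed by (simp add: act_shifted_mult act_mult[OF check_mult(3)])
  moreover have "act A (mult_mult_right s) ?y = act A (mult_mult_left s) ?x"
    unfolding act_isotopic[OF mult_assoc(3) y]
    by (rule act_cong)
      (use v check_isotopic_sound(1)[OF mult_assoc(3)] in
        \<open>auto simp: inputs_def glue_def mult_tangle_def shift_def Let_def rename_def\<close>)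
  ultimately show ?thesis by simp
qed

lemma star_mul:
  assumes v: "v \<in> spc A 2 s" "w \<in> spc A 2 s"
  shows "star A 2 s (mul A 2 s v w) = mul A 2 s (star A 2 s w) (star A 2 s v)"
proof -
  let ?x = "\<lambda>d::nat. if d = 1 then v else w"
  let ?y = "\<lambda>d. star A 2 s (?x d)"
  have "star A 2 s (mul A 2 s v w) = act A (reflect (mult_tangle 2 s)) ?y"
    using star_act[OF check_tangle_sound[OF check_mult(3)[of s]], of ?x] v
    by (simp add: mul_def inputs_def mult_tangle_def)
  also have "\<dots> = act A (mult_tangle 2 s) (?y \<circ> rename [(1, 2), (2, 1)])"
    using v star_spc by (intro act_isotopic[OF reflect_mult])
      (auto simp: inputs_def reflect_def mult_tangle_def Let_def)
  also have "\<dots> = mul A 2 s (star A 2 s w) (star A 2 s v)"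
    using v star_spc by (simp add: act_mult[OF check_mult(3)] rename_def)
  finally show ?thesis .
qed

lemma star_unit_1: "star A 1 s (unit A 1 s) = unit A 1 s"
proof -
  have "star A 1 s (unit A 1 s) = act A (reflect (unit_tangle 1 s)) (\<lambda>d. star A 1 s 0)"
    using star_act[OF check_tangle_sound[OF check_unit(2)[of s]], of "\<lambda>_. 0"]
    by (simp add: unit_def inputs_def unit_tangle_def)
  also have "\<dots> = act A (unit_tangle 1 s) ((\<lambda>d. star A 1 s 0) \<circ> id)"
    by (intro act_isotopic[OF reflect_unit]) (simp add: inputs_def reflect_def unit_tangle_def Let_def)
  finally show ?thesis using act_unit[OF check_unit(2)] by simp
qed

text \<open>
  Used at level 0, to identify \<open>P\<^bsub>0,s\<^esub>\<close> with the complex numbers, and at level 1, where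
  irreducibility provides a nonzero element.
\<close>

lemma one_dimensional_box:
  assumes "dim (spc A n s) = 1"
  obtains v where "v \<in> spc A n s" "v \<noteq> 0" "spc A n s \<subseteq> span {v}"
proof -
  obtain v where v: "v \<in> spc A n s" "independent {v}" "spc A n s \<subseteq> span {v}"
    using basis_exists[of "spc A n s"] assms by (metis card_1_singletonE insert_subset)
  moreover have "v \<noteq> 0" using v(2) by (metis dependent_zero insertI1)
  ultimately show ?thesis using that by blast
qed

lemma unit_0_generates:
  shows "unit A 0 s \<noteq> 0" and "x \<in> spc A 0 s \<Longrightarrow> \<exists>c. x = scl A c (unit A 0 s)"
proof -
  have "dim (spc A 0 s) = 1"
    using spa unfolding subfactor_planar_algebra_def by blast
  then obtain v where v: "v \<in> spc A 0 s" "v \<noteq> 0" "spc A 0 s \<subseteq> span {v}"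
    using one_dimensional_box by blast
  have "mul A 0 s 0 v = 0"
    using mul_linear(1)[OF check_mult(1) v(1) v(1) v(1), of 0 0] by simp
  then show u: "unit A 0 s \<noteq> 0" using unit_mul(1)[OF v(1)] v(2) by auto
  have "unit A 0 s \<in> span {v}" using v(3) unit_spc[OF check_unit(1)] by auto
  then obtain k where k: "unit A 0 s = scl A k v" by (auto simp: span_singleton)
  then have "k \<noteq> 0" using u by auto
  assume "x \<in> spc A 0 s"
  then obtain c where "x = scl A c v" using v(3) by (auto simp: span_singleton)
  then have "x = scl A (c / k) (unit A 0 s)" using \<open>k \<noteq> 0\<close> by (simp add: k)
  then show "\<exists>c. x = scl A c (unit A 0 s)" by blast
qed

lemma scalar_scale_unit [simp]: "scalar A s (scl A c (unit A 0 s)) = c"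
  unfolding scalar_def using unit_0_generates(1) by (intro the_equality) auto

lemma scalar_inverse: "x \<in> spc A 0 s \<Longrightarrow> x = scl A (scalar A s x) (unit A 0 s)"
  using unit_0_generates(2)[of x s] by auto

lemma scalar_linear:
  assumes "x \<in> spc A 0 s" "y \<in> spc A 0 s"
  shows "scalar A s (scl A a x + scl A b y) = a * scalar A s x + b * scalar A s y"
proof -
  obtain c d where "x = scl A c (unit A 0 s)" "y = scl A d (unit A 0 s)"
    using unit_0_generates(2) assms by metis
  then show ?thesis by (simp flip: scale_left_distrib)
qed

lemma act_trace_spc:
  assumes "check_tangle [] (trace_tangle n s)" "x \<in> spc A n s"
  shows "act A (trace_tangle n s) (\<lambda>_. x) \<in> spc A 0 s"
  using act_spc[OF check_tangle_sound[OF assms(1)], of "\<lambda>_. x"] assms(2)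
  by (simp add: inputs_def trace_tangle_def)

lemma tr_linear:
  assumes "check_tangle [] (trace_tangle n s)" "x \<in> spc A n s" "y \<in> spc A n s"
  shows "tr A n s (scl A a x + scl A b y) = a * tr A n s x + b * tr A n s y"
proof -
  let ?T = "trace_tangle n s"
  have T: "is_tangle ?T" by (rule check_tangle_sound[OF assms(1)])
  have upd: "act A ?T (\<lambda>_. v) = act A ?T ((\<lambda>_. 0)(1 := v))" if "v \<in> spc A n s" for v
    using that by (intro act_cong T) (auto simp: inputs_def trace_tangle_def)
  have closed: "scl A a x + scl A b y \<in> spc A n s"
    using assms subspace_spc by (intro subspace_add subspace_scale)
  have "act A ?T (\<lambda>_. scl A a x + scl A b y) = scl A a (act A ?T (\<lambda>_. x)) + scl A b (act A ?T (\<lambda>_. y))"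
    unfolding upd[OF closed] upd[OF assms(2)] upd[OF assms(3)]
    using assms subspace_0[OF subspace_spc] by (intro act_linear T) (auto simp: inputs_def trace_tangle_def)
  then show ?thesis
    unfolding tr_def using act_trace_spc[OF assms(1)] assms by (simp add: scalar_linear)
qed

lemma positive:
  "x \<in> spc A n s \<Longrightarrow> x \<noteq> 0 \<Longrightarrow> Im (tr A n s (mul A n s (star A n s x) x)) = 0 \<and>
     Re (tr A n s (mul A n s (star A n s x) x)) > 0"
  using spa unfolding subfactor_planar_algebra_def by blast

lemma spherical:
  "is_tangle T \<Longrightarrow> is_tangle T' \<Longrightarrow> bpts T 0 = 0 \<Longrightarrow>
   T' = T\<lparr>reg := (reg T)((0, 0) := r), unshaded := (unshaded T)(0 := s)\<rparr> \<Longrightarrow> x \<in> inputs A T \<Longrightarrow>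
   scalar A (unshaded T 0) (act A T x) = scalar A s (act A T' x)"
  using spa unfolding subfactor_planar_algebra_def spherical_def by blast

theorem box_algebra_2: "box_algebra A 2 s"
proof -
  have "\<exists>B. finite B \<and> span B = spc A 2 s"
    using spa unfolding subfactor_planar_algebra_def by blast
  then show ?thesis
    by unfold_locales
      (use subspace_spc unit_spc[OF check_unit(3)] mul_spc[OF check_mult(3)] star_spc
        mul_linear[OF check_mult(3)] mul_assoc unit_mul(3) mul_unit star_star star_linear star_mul
        tr_linear[OF check_trace(2)] positive in auto)
qed

definition loop_value :: "bool \<Rightarrow> complex" where
  "loop_value s = scalar A s (act A (loop_tangle s) (\<lambda>_. 0))"

lemma act_loop: "act A (loop_tangle s) x = scl A (loop_value s) (unit A 0 s)"
proof -
  have T: "is_tangle (loop_tangle s)" by (rule check_tangle_sound[OF check_loop])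
  have "act A (loop_tangle s) x = act A (loop_tangle s) (\<lambda>_. 0)"
    by (intro act_no_discs T) (simp add: loop_tangle_def)
  moreover have "act A (loop_tangle s) (\<lambda>_. 0) \<in> spc A 0 s"
    using act_spc[OF T, of "\<lambda>_. 0"] by (simp add: inputs_def loop_tangle_def)
  ultimately show ?thesis using scalar_inverse by (simp add: loop_value_def)
qed

text \<open>
  On the sphere a circle has no inside, so its value does not depend on the shading.
\<close>

lemma loop_value_shading: "loop_value True = loop_value False"
proof -
  have x: "(\<lambda>_. 0) \<in> inputs A (loop_tangle s)" for s by (simp add: inputs_def loop_tangle_def)
  have "loop_value True = scalar A False (act A inside_out_loop (\<lambda>_. 0))"
    using spherical[OF check_tangle_sound[OF check_loop[of True]] check_isotopic_sound(1)[OF inside_out_loop] _ refl x]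
    by (simp add: loop_value_def loop_tangle_def)
  then show ?thesis
    using act_isotopic[OF inside_out_loop x] by (simp add: loop_value_def o_def)
qed

lemma tr_unit_1: "tr A 1 s (unit A 1 s) = loop_value s"
proof -
  have x: "(\<lambda>_. 0) \<in> inputs A (trace_unit_1 s)" "(\<lambda>_. 0) \<in> inputs A (loop_tangle s)"
    by (simp_all add: inputs_def glue_def trace_tangle_def unit_tangle_def loop_tangle_def)
  have "act A (trace_unit_1 s) (\<lambda>_. 0) = act A (trace_tangle 1 s) (\<lambda>_. unit A 1 s)"
    unfolding act_glue[OF trace_unit_1(1) x(1)] act_unit[OF check_unit(2)]
    using unit_spc[OF check_unit(2)]
    by (intro act_cong check_tangle_sound[OF check_trace(1)]) (auto simp: inputs_def trace_tangle_def)
  then show ?thesis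
    using act_isotopic[OF trace_unit_1(2) x(2)] by (simp add: tr_def loop_value_def o_def)
qed

text \<open>
  Evaluating the inner circle first leaves the outer one around an empty picture.
\<close>

lemma tr_unit_2: "tr A 2 s (unit A 2 s) = loop_value s * loop_value (\<not> s)"
proof -
  have x: "(\<lambda>_. 0) \<in> inputs A (trace_unit_2 s)" "(\<lambda>_. 0) \<in> inputs A (ring_loop s)"
    "(\<lambda>_. 0) \<in> inputs A (ring_unit s)" "(\<lambda>_. 0) \<in> inputs A (loop_tangle s)" "(\<lambda>_. 0) \<in> inputs A (ring_tangle s)"
    using subspace_0[OF subspace_spc]
    by (simp_all add: inputs_def glue_def trace_tangle_def unit_tangle_def loop_tangle_def ring_tangle_def)
  let ?R = "ring_tangle s" and ?u = "unit A 0 (\<not> s)"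
  have R: "is_tangle ?R" by (rule check_tangle_sound[OF check_ring])
  have "act A (trace_unit_2 s) (\<lambda>_. 0) = act A (trace_tangle 2 s) (\<lambda>_. unit A 2 s)"
    unfolding act_glue[OF trace_unit_2(1) x(1)] act_unit[OF check_unit(3)]
    using unit_spc[OF check_unit(3)]
    by (intro act_cong check_tangle_sound[OF check_trace(2)]) (auto simp: inputs_def trace_tangle_def)
  then have "act A (trace_tangle 2 s) (\<lambda>_. unit A 2 s) = act A (ring_loop s) (\<lambda>_. 0)"
    using act_isotopic[OF trace_unit_2(3) x(2)] by (simp add: o_def)
  also have "\<dots> = act A ?R ((\<lambda>_. 0)(1 := scl A (loop_value (\<not> s)) ?u + scl A 0 ?u))"
    unfolding act_glue[OF trace_unit_2(2) x(2)] act_loop by simp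
  also have "\<dots> = scl A (loop_value (\<not> s)) (act A ?R ((\<lambda>_. 0)(1 := ?u)))"
    using unit_spc[OF check_unit(1), of "\<not> s"] x(5)
    by (subst act_linear[OF R]) (auto simp: ring_tangle_def)
  also have "act A ?R ((\<lambda>_. 0)(1 := ?u)) = act A (ring_unit s) (\<lambda>_. 0)"
    unfolding act_glue[OF ring_unit(1) x(3)] act_unit[OF check_unit(1)] ..
  also have "\<dots> = act A (loop_tangle s) (\<lambda>_. 0)"
    using act_isotopic[OF ring_unit(2) x(4)] by (simp add: o_def)
  finally show ?thesis by (simp add: tr_def act_loop mult.commute)
qed

lemma fourier_spc: "x \<in> spc A 2 s \<Longrightarrow> fourier A s x \<in> spc A 2 (\<not> s)"
  using act_spc[OF check_tangle_sound[OF check_rotation(1)], of "\<lambda>_. x"]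
  by (simp add: fourier_def inputs_def rotation_tangle_def)

lemma fourier_scale:
  assumes "x \<in> spc A 2 s"
  shows "fourier A s (scl A c x) = scl A c (fourier A s x)"
proof -
  let ?T = "rotation_tangle 2 s"
  have T: "is_tangle ?T" by (rule check_tangle_sound[OF check_rotation(1)])
  have upd: "act A ?T (\<lambda>_. v) = act A ?T ((\<lambda>_. 0)(1 := v))" if "v \<in> spc A 2 s" for v
    using that by (intro act_cong T) (auto simp: inputs_def rotation_tangle_def)
  have closed: "scl A c x \<in> spc A 2 s" using assms subspace_spc by (intro subspace_scale)
  have "act A ?T ((\<lambda>_. 0)(1 := scl A c x + scl A 0 x)) = scl A c (act A ?T ((\<lambda>_. 0)(1 := x))) + scl A 0 (act A ?T ((\<lambda>_. 0)(1 := x)))"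
    using assms subspace_0[OF subspace_spc] by (intro act_linear T) (auto simp: inputs_def rotation_tangle_def)
  then show ?thesis unfolding fourier_def upd[OF closed] upd[OF assms] by simp
qed

lemma star_fourier:
  assumes "x \<in> spc A 2 s"
  shows "star A 2 (\<not> s) (fourier A s x) = act A (reflect (rotation_tangle 2 s)) (\<lambda>_. star A 2 s x)"
proof -
  let ?R = "rotation_tangle 2 s"
  have R: "bpts ?R d = 2" "unshaded ?R d = (if d = 0 then \<not> s else s)" "discs ?R = {1}" for d
    by (simp_all add: rotation_tangle_def)
  have "star A 2 (\<not> s) (fourier A s x) = act A (reflect ?R) (\<lambda>d. star A 2 (if d = 0 then \<not> s else s) x)"
    using star_act[OF check_tangle_sound[OF check_rotation(1)[of s]], of "\<lambda>_. x"] assms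
    by (simp add: fourier_def inputs_def R)
  also have "\<dots> = act A (reflect ?R) (\<lambda>_. star A 2 s x)"
    by (intro act_cong check_tangle_sound[OF check_rotation(2)])
      (use assms star_spc in \<open>auto simp: inputs_def reflect_def Let_def R\<close>)
  finally show ?thesis .
qed

lemma act_trace: 
  assumes "check_tangle [] (trace_tangle n s)" "x 1 \<in> spc A n s"
  shows "act A (trace_tangle n s) x = act A (trace_tangle n s) (\<lambda>_. x 1)"
  using assms(2) by (intro act_cong check_tangle_sound[OF assms(1)]) (auto simp: inputs_def trace_tangle_def)

text \<open>
  On both sides stands the value of the same picture on the sphere: a disc labelled \<open>x\<close> and a disc
  labelled by its adjoint, joined by four strings. The Fourier transform turns the discs, which
  amounts to moving the output disc into the neighbouring region.
\<close>

theorem fourier_isometry: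
  assumes x: "x \<in> spc A 2 s"
  shows "tr A 2 (\<not> s) (mul A 2 (\<not> s) (star A 2 (\<not> s) (fourier A s x)) (fourier A s x)) =
    tr A 2 s (mul A 2 s (star A 2 s x) x)"
proof -
  \<comment> \<open>In all pictures disc 3 carries the adjoint and disc 4 carries \<open>x\<close>.\<close>
  let ?X = "\<lambda>d::nat. if d = 3 then star A 2 s x else x"
  let ?F = "fourier A s x"
  note closed = x star_spc[OF x] fourier_spc[OF x] star_spc[OF fourier_spc[OF x]]
  note simps = inputs_def glue_def mult_tangle_def shift_def Let_def trace_tangle_def reflect_def rotation_tangle_def
  have inputs: "?X \<in> inputs A (pairing s)" "?X \<in> inputs A (rotated_pairing s)" "?X \<in> inputs A (rotated_mult s)"
    using closed by (auto simp: simps)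
  have "act A (pairing s) ?X = act A (trace_tangle 2 s) (\<lambda>_. mul A 2 s (star A 2 s x) x)"
  proof -
    have "act A (shift 2 (mult_tangle 2 s)) ?X = mul A 2 s (star A 2 s x) x"
      using act_shifted_mult[of ?X s] closed by simp
    then show ?thesis
      unfolding act_glue[OF pairing inputs(1)]
      by (subst act_trace[OF check_trace(2)]) (use closed mul_spc[OF check_mult(3)] in simp_all)
  qed
  then have 1: "scalar A s (act A (pairing s) ?X) = tr A 2 s (mul A 2 s (star A 2 s x) x)"
    by (simp add: tr_def)
  have F: "act A (shift 3 (rotation_tangle 2 s)) ?X = ?F"
  proof -
    have "act A (shift 3 (rotation_tangle 2 s)) ?X =
        act A (rotation_tangle 2 s) (\<lambda>d. ?X (if d = 0 then 0 else d + 3))"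
      by (rule act_shift[OF check_rotation(1) check_glueD(1)[OF rotated_mult]]) (use closed in \<open>auto simp: simps\<close>)
    also have "\<dots> = ?F" unfolding fourier_def
      by (intro act_cong check_tangle_sound[OF check_rotation(1)]) (use closed in \<open>auto simp: simps\<close>)
    finally show ?thesis .
  qed
  let ?Y = "?X(2 := ?F)"
  have Y: "?Y \<in> inputs A (half_rotated_mult s)" using closed by (auto simp: simps)
  have F': "act A (shift 2 (reflect (rotation_tangle 2 s))) ?Y = star A 2 (\<not> s) ?F"
  proof -
    have "act A (shift 2 (reflect (rotation_tangle 2 s))) ?Y =
        act A (reflect (rotation_tangle 2 s)) (\<lambda>d. ?Y (if d = 0 then 0 else d + 2))"
      by (rule act_shift[OF check_rotation(2) check_glueD(1)[OF half_rotated_mult]]) (use closed in \<open>auto simp: simps\<close>)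
    also have "\<dots> = star A 2 (\<not> s) ?F" unfolding star_fourier[OF x]
      by (intro act_cong check_tangle_sound[OF check_rotation(2)]) (use closed in \<open>auto simp: simps\<close>)
    finally show ?thesis .
  qed
  have "act A (rotated_mult s) ?X = mul A 2 (\<not> s) (star A 2 (\<not> s) ?F) ?F"
    unfolding act_glue[OF rotated_mult inputs(3)] F act_glue[OF half_rotated_mult Y] F'
    using closed by (simp add: act_mult[OF check_mult(3)])
  then have "act A (rotated_pairing s) ?X =
      act A (trace_tangle 2 (\<not> s)) (\<lambda>_. mul A 2 (\<not> s) (star A 2 (\<not> s) ?F) ?F)"
    unfolding act_glue[OF rotated_pairing inputs(2)]
    by (subst act_trace[OF check_trace(2)]) (use closed mul_spc[OF check_mult(3)] in simp_all)
  then have 2: "scalar A (\<not> s) (act A (rotated_pairing s) ?X) =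
      tr A 2 (\<not> s) (mul A 2 (\<not> s) (star A 2 (\<not> s) ?F) ?F)"
    by (simp add: tr_def)
  have "scalar A (unshaded (pairing s) 0) (act A (pairing s) ?X) = scalar A (\<not> s) (act A (moved_pairing s) ?X)"
    by (rule spherical[OF check_tangle_sound[OF check_glueD(2)[OF pairing]]
        check_isotopic_sound(1)[OF moved_pairing] _ refl inputs(1)])
      (simp add: simps)
  moreover have "act A (rotated_pairing s) ?X = act A (moved_pairing s) ?X"
    using act_isotopic[OF moved_pairing inputs(2)] by (simp add: o_def)
  moreover have "unshaded (pairing s) 0 = s" by (simp add: simps)
  ultimately show ?thesis using 1 2 by simp
qed

end

section \<open>Norm bounds for the Fourier transform\<close>

context subfactor_pa begin

context
  assumes irreducible: "irreducible_planar A"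
begin

text \<open>
  The value of a circle is \<open>tr (1\<^sup>\<star> 1)\<close> at level 1, and this is positive unless the unit vanishes.
  Irreducibility rules out that \<open>P\<^bsub>1,s\<^esub>\<close> is zero.
\<close>

lemma loop_value_eq_delta: "loop_value s = of_real (delta A)" and delta_pos: "delta A > 0"
proof -
  have "dim (spc A 1 True) = 1" using irreducible by (simp add: irreducible_planar_def)
  then obtain v where v: "v \<in> spc A 1 True" "v \<noteq> 0" using one_dimensional_box by metis
  let ?u = "unit A 1 True"
  have u: "?u \<in> spc A 1 True" by (rule unit_spc[OF check_unit(2)])
  have "?u \<noteq> 0"
  proof
    assume "?u = 0"
    moreover have "mul A 1 True 0 v = 0"
      using mul_linear(1)[OF check_mult(2) v(1) v(1) v(1), of 0 0] by simp
    ultimately show False using unit_mul(2)[OF v(1)] v(2) by simp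
  qed
  then have pos: "Im (loop_value True) = 0" "Re (loop_value True) > 0"
    using positive[OF u] unfolding star_unit_1 unit_mul(2)[OF u] tr_unit_1 by blast+
  have d: "delta A = Re (loop_value True)" by (simp add: delta_def loop_value_def)
  show "delta A > 0" using pos d by simp
  have "loop_value s = loop_value True" using loop_value_shading by (cases s) auto
  then show "loop_value s = of_real (delta A)" using pos d by (simp add: complex_eq_iff)
qed

lemma tr_unit_delta: "Re (tr A 2 s (unit A 2 s)) = (delta A)\<^sup>2"
  by (simp add: tr_unit_2 loop_value_eq_delta power2_eq_square flip: of_real_mult)

lemma delta_square_powr: "(delta A)\<^sup>2 powr k = delta A powr (2 * k)"
proof -
  have "(delta A)\<^sup>2 = delta A powr 2" using delta_pos by simp
  then show ?thesis by (simp only: powr_powr)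
qed

lemma L2_length_fourier: "x \<in> spc A 2 s \<Longrightarrow> L2_length A 2 (\<not> s) (fourier A s x) = L2_length A 2 s x"
  by (simp add: L2_length_def fourier_isometry)

abbreviation growth :: "ennreal \<Rightarrow> ennreal \<Rightarrow> real" where
  "growth p q \<equiv> delta A powr (2 * recip q - 2 * recip p)"

lemma growth_split:
  "growth p q * (delta A powr (2 * recip p - t) * y) = delta A powr (2 * recip q - t) * y"
proof -
  have "growth p q * delta A powr (2 * recip p - t) = delta A powr (2 * recip q - t)"
    using delta_pos by (simp flip: powr_add)
  then show ?thesis by (simp flip: mult.assoc)
qed

text \<open>
  Both estimates pass through the 2-norm of \<open>x\<close>, which is also the 2-norm of its transform.
\<close>

lemma fourier_norm_bounds:
  assumes x: "x \<in> spc A 2 s" and "0 < p" "0 < q" "recip p \<le> 1 / 2" "recip q \<ge> 1 / 2"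
  shows "delta A powr (2 * recip p - 1) * L2_length A 2 s x \<le> p_norm A s p x"
    and "p_norm A (\<not> s) q (fourier A s x) \<le> delta A powr (2 * recip q - 1) * L2_length A 2 s x"
proof -
  interpret P: box_algebra A 2 s by (rule box_algebra_2)
  interpret Q: box_algebra A 2 "\<not> s" by (rule box_algebra_2)
  have pos: "(delta A)\<^sup>2 > 0" using delta_pos by simp
  show "delta A powr (2 * recip p - 1) * L2_length A 2 s x \<le> p_norm A s p x"
    using P.p_norm_compare_L2(1)[OF refl x \<open>0 < p\<close>] assms pos
    by (simp add: tr_unit_delta delta_square_powr right_diff_distrib)
  show "p_norm A (\<not> s) q (fourier A s x) \<le> delta A powr (2 * recip q - 1) * L2_length A 2 s x"
    using Q.p_norm_compare_L2(2)[OF refl fourier_spc[OF x] \<open>0 < q\<close>] assms pos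
    by (simp add: tr_unit_delta delta_square_powr right_diff_distrib L2_length_fourier)
qed

theorem fourier_hausdorff_young:
  assumes x: "x \<in> spc A 2 s" and "0 < p" "0 < q" "recip p \<le> 1 / 2" "recip q \<ge> 1 / 2"
  shows "p_norm A (\<not> s) q (fourier A s x) \<le> growth p q * p_norm A s p x"
proof -
  have "growth p q * (delta A powr (2 * recip p - 1) * L2_length A 2 s x) \<le> growth p q * p_norm A s p x"
    using fourier_norm_bounds(1)[OF assms] by (intro mult_left_mono) auto
  then show ?thesis
    using fourier_norm_bounds(2)[OF assms] unfolding growth_split by linarith
qed

lemma scaled_isometry_imp_unitary:
  assumes u: "u \<in> spc A 2 s" and "mul A 2 s (star A 2 s u) u = unit A 2 s"
  shows "unitary A s u"
proof -
  interpret box_algebra A 2 s by (rule box_algebra_2)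
  show ?thesis
    using assms left_inverse_imp_right_inverse[OF u star_spc[OF u]] by (simp add: unitary_def)
qed

text \<open>
  Equality makes both estimates through the 2-norm sharp, so \<open>x\<^sup>\<star> x\<close> and the corresponding product
  of the transform are scalars. The scalars agree because the 2-norms do; after rescaling, \<open>x\<close> and
  its transform are isometries and hence unitaries.
\<close>

lemma extremal_imp_multiple_of_biunitary:
  assumes x: "x \<in> spc A 2 s" and pq: "0 < p" "0 < q" "recip p < 1 / 2" "recip q > 1 / 2"
    and eq: "p_norm A (\<not> s) q (fourier A s x) = growth p q * p_norm A s p x"
    and ex: "\<exists>u. biunitary A s u"
  shows "\<exists>c u. biunitary A s u \<and> x = scl A c u"
proof -
  interpret P: box_algebra A 2 s by (rule box_algebra_2)
  interpret Q: box_algebra A 2 "\<not> s" by (rule box_algebra_2)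
  have pos: "(delta A)\<^sup>2 > 0" using delta_pos by simp
  let ?F = "fourier A s x"
  have F: "?F \<in> spc A 2 (\<not> s)" using fourier_spc[OF x] .
  have pq': "recip p \<le> 1 / 2" "recip q \<ge> 1 / 2" using pq by auto
  have lower: "delta A powr (2 * recip p - 1) * L2_length A 2 s x \<le> p_norm A s p x"
    and upper: "p_norm A (\<not> s) q ?F \<le> delta A powr (2 * recip q - 1) * L2_length A 2 s x"
    using fourier_norm_bounds[OF x pq(1,2) pq'] .
  have g: "growth p q > 0" using delta_pos by simp
  have "growth p q * p_norm A s p x \<le> growth p q * (delta A powr (2 * recip p - 1) * L2_length A 2 s x)"
    using upper unfolding eq growth_split .
  then have p: "p_norm A s p x = delta A powr (2 * recip p - 1) * L2_length A 2 s x"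
    using g lower by (simp add: mult_le_cancel_left_pos)
  have q: "p_norm A (\<not> s) q ?F = delta A powr (2 * recip q - 1) * L2_length A 2 s x"
    unfolding eq p growth_split ..
  obtain m where m: "m \<ge> 0" "mul A 2 s (star A 2 s x) x = scl A (of_real m) (unit A 2 s)"
    using P.p_norm_compare_L2(3)[OF refl x pq(1)] p pq(3) pos
    by (auto simp: tr_unit_delta delta_square_powr right_diff_distrib)
  obtain m' where m': "mul A 2 (\<not> s) (star A 2 (\<not> s) ?F) ?F = scl A (of_real m') (unit A 2 (\<not> s))"
    using Q.p_norm_compare_L2(3)[OF refl F pq(2)] q pq(4) pos
    by (auto simp: tr_unit_delta delta_square_powr right_diff_distrib L2_length_fourier x)
  have "m' * (delta A)\<^sup>2 = m * (delta A)\<^sup>2"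
    using arg_cong[OF fourier_isometry[OF x], of Re] unfolding m m'
    by (simp add: tr_unit_delta)
  then have "m' = m" using pos by simp
  show ?thesis
  proof (cases "m = 0")
    case True
    then have "x = 0" using m P.faithful[OF x] by simp
    then show ?thesis using ex by (metis scale_zero_left)
  next
    case False
    define c :: complex where "c = of_real (1 / sqrt m)"
    have c: "c * (cnj c * of_real m) = 1"
      using False m(1) by (simp add: c_def flip: of_real_mult)
    let ?u = "scl A c x"
    have u: "?u \<in> spc A 2 s" using x by simp
    have Fu: "fourier A s ?u = scl A c ?F" using fourier_scale[OF x] .
    have "mul A 2 s (star A 2 s ?u) ?u = unit A 2 s"
      using x c by (simp add: m)
    moreover have "mul A 2 (\<not> s) (star A 2 (\<not> s) (scl A c ?F)) (scl A c ?F) = unit A 2 (\<not> s)"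
      using F c by (simp add: m' \<open>m' = m\<close>)
    ultimately have "biunitary A s ?u"
      using u F by (simp add: biunitary_def Fu scaled_isometry_imp_unitary)
    moreover have "x = scl A (of_real (sqrt m)) ?u"
      using False m(1) by (simp add: c_def flip: of_real_mult)
    ultimately show ?thesis by blast
  qed
qed

lemma p_norm_multiple_of_biunitary:
  assumes u: "biunitary A s u"
  shows "0 < p \<Longrightarrow> p_norm A s p (scl A c u) = cmod c * delta A powr (2 * recip p)"
    and "0 < q \<Longrightarrow> p_norm A (\<not> s) q (fourier A s (scl A c u)) = cmod c * delta A powr (2 * recip q)"
proof -
  interpret P: box_algebra A 2 s by (rule box_algebra_2)
  interpret Q: box_algebra A 2 "\<not> s" by (rule box_algebra_2)
  have pos: "(delta A)\<^sup>2 > 0" using delta_pos by simp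
  have u1: "u \<in> spc A 2 s" "mul A 2 s (star A 2 s u) u = unit A 2 s"
    and u2: "fourier A s u \<in> spc A 2 (\<not> s)"
      "mul A 2 (\<not> s) (star A 2 (\<not> s) (fourier A s u)) (fourier A s u) = unit A 2 (\<not> s)"
    using u by (simp_all add: biunitary_def unitary_def)
  have c: "c * cnj c = (of_real (cmod c))\<^sup>2"
    using complex_norm_square[of c] by simp
  show "p_norm A s p (scl A c u) = cmod c * delta A powr (2 * recip p)" if "0 < p"
    using P.p_norm_of_scaled_isometry[OF refl _ that, of "scl A c u" "(cmod c)\<^sup>2"] u1 c pos
    by (simp add: tr_unit_delta delta_square_powr)
  show "p_norm A (\<not> s) q (fourier A s (scl A c u)) = cmod c * delta A powr (2 * recip q)" if "0 < q"
    using Q.p_norm_of_scaled_isometry[OF refl _ that, of "scl A c (fourier A s u)" "(cmod c)\<^sup>2"] u2 c pos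
    by (simp add: tr_unit_delta delta_square_powr fourier_scale[OF u1(1)])
qed

lemma biunitary_extremal:
  assumes "biunitary A s u" "0 < p" "0 < q"
  shows "p_norm A (\<not> s) q (fourier A s (scl A c u)) = growth p q * p_norm A s p (scl A c u)"
proof -
  have "growth p q * (delta A powr (2 * recip p - 0) * cmod c) = delta A powr (2 * recip q - 0) * cmod c"
    by (rule growth_split)
  then show ?thesis
    unfolding p_norm_multiple_of_biunitary(1)[OF assms(1,2)] p_norm_multiple_of_biunitary(2)[OF assms(1,3)]
    by (simp only: diff_zero mult.commute[of "cmod c"])
qed

lemma C_const_le:
  assumes "0 < p" "0 < q" "recip p \<le> 1 / 2" "recip q \<ge> 1 / 2"
  shows "C_const A s p q \<le> ennreal (growth p q)"
  unfolding C_const_def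
proof (rule SUP_least)
  fix x assume "x \<in> {x \<in> spc A 2 s. p_norm A s p x = 1}"
  then show "ennreal (p_norm A (\<not> s) q (fourier A s x)) \<le> ennreal (growth p q)"
    using fourier_hausdorff_young[of x s p q] assms by (intro ennreal_leI) simp
qed

lemma C_const_eq:
  assumes "0 < p" "0 < q" "recip p \<le> 1 / 2" "recip q \<ge> 1 / 2" and u: "biunitary A s u"
  shows "C_const A s p q = ennreal (growth p q)"
proof (rule antisym[OF C_const_le[OF assms(1-4)]])
  define c :: complex where "c = of_real (delta A powr (- (2 * recip p)))"
  let ?x = "scl A c u"
  have "?x \<in> spc A 2 s"
    using u subspace_scale[OF subspace_spc] by (simp add: biunitary_def unitary_def)
  moreover have norm: "p_norm A s p ?x = 1"
    using p_norm_multiple_of_biunitary(1)[OF u assms(1)] delta_pos by (simp add: c_def flip: powr_add)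
  ultimately have "ennreal (p_norm A (\<not> s) q (fourier A s ?x)) \<le> C_const A s p q"
    unfolding C_const_def by (intro SUP_upper) simp
  then show "ennreal (growth p q) \<le> C_const A s p q"
    using biunitary_extremal[OF u assms(1,2), of c] norm by simp
qed

end
end

theorem proposition3p5:
  fixes A :: "('a::ab_group_add) planar" and s :: bool and p q :: ennreal
  assumes "subfactor_planar_algebra A" and "irreducible_planar A"
    and "0 < p" and "0 < q" and "recip p \<le> 1 / 2" and "recip q \<ge> 1 / 2"
  shows "C_const A s p q \<le> ennreal (delta A powr (2 * recip q - 2 * recip p)) \<and>
    ((\<exists>u. biunitary A s u) \<longrightarrow>
      (\<forall>x\<in>spc A 2 s.
        ((\<exists>p q. 0 < p \<and> 0 < q \<and> recip p < 1 / 2 \<and> recip q > 1 / 2 \<and>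
            p_norm A (\<not> s) q (fourier A s x) =
              delta A powr (2 * recip q - 2 * recip p) * p_norm A s p x) \<longleftrightarrow>
         (\<forall>p q. 0 < p \<and> 0 < q \<and> recip p \<le> 1 / 2 \<and> recip q \<ge> 1 / 2 \<longrightarrow>
            p_norm A (\<not> s) q (fourier A s x) =
              delta A powr (2 * recip q - 2 * recip p) * p_norm A s p x)) \<and>
        ((\<forall>p q. 0 < p \<and> 0 < q \<and> recip p \<le> 1 / 2 \<and> recip q \<ge> 1 / 2 \<longrightarrow>
            p_norm A (\<not> s) q (fourier A s x) =
              delta A powr (2 * recip q - 2 * recip p) * p_norm A s p x) \<longleftrightarrow>
         (\<exists>c u. biunitary A s u \<and> x = scl A c u)))) \<and>
    ((\<exists>u. biunitary A s u) \<longrightarrow>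
      C_const A s p q = ennreal (delta A powr (2 * recip q - 2 * recip p)))"
proof -
  interpret subfactor_pa A by (rule subfactor_pa.intro[OF assms(1)])
  note irr = assms(2)
  define attained where "attained = (\<lambda>x p q. p_norm A (\<not> s) q (fourier A s x) =
    delta A powr (2 * recip q - 2 * recip p) * p_norm A s p x)"
  define strictly where "strictly = (\<lambda>x. \<exists>p q. 0 < p \<and> 0 < q \<and> recip p < 1 / 2 \<and> recip q > 1 / 2 \<and> attained x p q)"
  define always where "always = (\<lambda>x. \<forall>p q. 0 < p \<and> 0 < q \<and> recip p \<le> 1 / 2 \<and> recip q \<ge> 1 / 2 \<longrightarrow> attained x p q)"
  have C: "C_const A s p q \<le> ennreal (delta A powr (2 * recip q - 2 * recip p))"
    by (rule C_const_le[OF irr assms(3-6)])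
  have C': "C_const A s p q = ennreal (delta A powr (2 * recip q - 2 * recip p))" if "\<exists>u. biunitary A s u"
    using that C_const_eq[OF irr assms(3-6)] by blast
  have "(strictly x \<longleftrightarrow> always x) \<and> (always x \<longleftrightarrow> (\<exists>c u. biunitary A s u \<and> x = scl A c u))"
    if ex: "\<exists>u. biunitary A s u" and x: "x \<in> spc A 2 s" for x
  proof -
    have "\<exists>c u. biunitary A s u \<and> x = scl A c u" if "strictly x"
      using that extremal_imp_multiple_of_biunitary[OF irr x _ _ _ _ _ ex]
      unfolding strictly_def attained_def by blast
    moreover have "always x" if "\<exists>c u. biunitary A s u \<and> x = scl A c u"
      using that biunitary_extremal[OF irr] unfolding always_def attained_def by blast
    moreover have "strictly x" if "always x"
    proof -
      have "recip \<infinity> = 0" "recip 1 = 1" using recip_simps(1) recip_simps(2)[of 1] by simp_all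
      moreover have "attained x \<infinity> 1" using that calculation by (simp add: always_def)
      ultimately have "0 < (\<infinity> :: ennreal) \<and> 0 < (1 :: ennreal) \<and> recip \<infinity> < 1 / 2 \<and> recip 1 > 1 / 2 \<and> attained x \<infinity> 1"
        by simp
      then show ?thesis unfolding strictly_def by blast
    qed
    ultimately show ?thesis by blast
  qed
  then show ?thesis
    using C C' unfolding strictly_def always_def attained_def by blast
qed

end
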